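(* Suppose that $\Gamma$ is finite and let $\mathcal{T}$ be a family of forward complete trajectories of $\dot x=f(x,\sigma)$ such that $\sigma\in\mathcal{S}_e\cap\mathcal{S}_d$ for every $(x,\sigma)\in\mathcal{T}$. For $\gamma\in\Gamma$ let $E_\gamma=\{\xi\in\chi_\gamma:f_\gamma(\xi)=0\}$. Suppose that there exists an F-weak Lyapunov pair $(V,W)$ for $\mathcal{T}$ such that for all $\gamma\in\Gamma$ either $\mathcal{O}_\gamma^b(f_\gamma,W_\gamma)=E_\gamma\cap\mathcal{O}_\gamma$ or $\mathcal{O}_\gamma^f(f_\gamma,W_\gamma)=E_\gamma\cap\mathcal{O}_\gamma$, and that $\bigcap_{\gamma\in\Gamma}(E_\gamma\cap\mathcal{O}_\gamma)=\{0\}$. Then $\mathcal{T}$ is locally asymptotically stable (LAS). If, in addition, $\mathcal{O}=\mathbb{R}^n$ and $V$ is radially unbounded, then $\mathcal{T}$ is globally asymptotically stable (GAS).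
   Context: Setting: $\Gamma$ is a compact metric space (here finite), $\mathrm{dom}(f)\subset\mathbb{R}^n\times\Gamma$ is closed and $f:\mathrm{dom}(f)\to\mathbb{R}^n$ is continuous. For $\gamma\in\Gamma$, $\chi_\gamma=\{\xi\in\mathbb{R}^n:(\xi,\gamma)\in\mathrm{dom}(f)\}$ and $f_\gamma:\chi_\gamma\to\mathbb{R}^n$, $f_\gamma(\xi)=f(\xi,\gamma)$. A switching signal is a function $\sigma:\mathbb{R}\to\Gamma$ that is piecewise constant (at most finitely many jumps in each compact interval) and continuous from the right; $\Lambda(\sigma)$ is the set of times at which $\sigma$ has a jump. A solution of $\dot x=f(x,\sigma)$ corresponding to $\sigma$ is a locally absolutely continuous $x:I_x\to\mathbb{R}^n$, $I_x\subset\mathbb{R}$ a nonempty interval, with $(x(t),\sigma(t))\in\mathrm{dom}(f)$ for all $t\in I_x$ and $\dot x(t)=f(x(t),\sigma(t))$ for almost all $t\in I_x$. Then $(x,\sigma)$ is called a trajectory; it is forward complete if $\mathbb{R}_{\ge0}\subset I_x$. $\mathcal{S}_d=\bigcup_{\tau_D>0}\mathcal{S}_d[\tau_D]$, where $\mathcal{S}_d[\tau_D]$ is the set of switching signals with $|t-t'|\ge\tau_D$ for all $t\ne t'$ in $\Lambda(\sigma)$. $\mathcal{S}_e=\bigcup_{T>0}\mathcal{S}_e[T]$, where $\mathcal{S}_e[T]$ is the set of switching signals $\sigma$ such that $\sigma^{-1}(\gamma)\cap[t_0,t_0+T]\ne\emptyset$ for every $t_0\ge0$ and every $\gamma\in\Gamma$.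 $\pi_1:\mathbb{R}^n\times\Gamma\to\mathbb{R}^n$ is the projection onto the first component. Class $\mathcal{V}$: $V:\mathrm{dom}(V)\to\mathbb{R}$ belongs to $\mathcal{V}$ if $\mathrm{dom}(V)\subset\mathbb{R}^n\times\Gamma$; for every $\gamma\in\Gamma$ the set $\mathcal{D}_\gamma=\{\xi:(\xi,\gamma)\in\mathrm{dom}(V)\}$ is open; with $\mathcal{O}=\pi_1(\mathrm{dom}(V))$ and $\mathcal{O}_\gamma=\mathcal{O}\cap\chi_\gamma$, one has $\mathcal{O}_\gamma\subset\mathcal{D}_\gamma$ for all $\gamma$; and for all $\gamma$, $V_\gamma(\cdot)=V(\cdot,\gamma)$ is differentiable on $\mathcal{O}_\gamma$. Observability-like sets: given $\mathcal{X}\subset\mathbb{R}^n$, a continuous map $g:\mathcal{X}\to\mathbb{R}^n$, a function $h:\mathcal{X}\to\mathbb{R}$ and $\tau>0$, $\mathcal{X}^f(g,h,\tau)$ (resp. $\mathcal{X}^b(g,h,\tau)$) is the set of $\xi\in\mathcal{X}$ for which there is a solution $\varphi:[0,\tau]\to\mathcal{X}$ (resp. $\varphi:[-\tau,0]\to\mathcal{X}$) of $\dot x=g(x)$ with $\varphi(0)=\xi$ and $h(\varphi(t))=0$ for all $t\in[0,\tau]$ (resp. $t\in[-\tau,0]$). Also $\mathcal{X}^f(g,h)=\bigcup_{\tau>0}\mathcal{X}^f(g,h,\tau)$ and $\mathcal{X}^b(g,h)=\bigcup_{\tau>0}\mathcal{X}^b(g,h,\tau)$. The sets $\mathcal{O}_\gamma^{f}(f_\gamma,W_\gamma)$,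 $\mathcal{O}_\gamma^{b}(f_\gamma,W_\gamma)$ are these sets with $\mathcal{X}=\mathcal{O}_\gamma$, $g=f_\gamma|_{\mathcal{O}_\gamma}$, $h=W_\gamma:=W(\cdot,\gamma)$. Comparison functions: a class $\mathcal{K}$ function is $\alpha:[0,r]\to\mathbb{R}_{\ge0}$ strictly increasing, continuous, with $\alpha(0)=0$; a class $\mathcal{K}_\infty$ function is one with $r=+\infty$ (domain $[0,\infty)$) that is in addition unbounded. Stability: a family $\mathcal{T}$ of forward complete trajectories is: LUS if there exist $r>0$ and $\alpha:[0,r]\to\mathbb{R}$ of class $\mathcal{K}$ such that for all $(x,\sigma)\in\mathcal{T}$ and all $t_0\ge0$, $|x(t_0)|\le r$ implies $|x(t)|\le\alpha(|x(t_0)|)$ for all $t\ge t_0$; GUS if there exists $\alpha:[0,\infty)\to\mathbb{R}$ of class $\mathcal{K}_\infty$ such that for all $(x,\sigma)\in\mathcal{T}$, $|x(t)|\le\alpha(|x(t_0)|)$ for all $t\ge t_0\ge0$; LAS (locally asymptotically stable) if it is LUS and there exists $\eta>0$ such that $\lim_{t\to+\infty}x(t)=0$ for all $(x,\sigma)\in\mathcal{T}$ with $|x(0)|<\eta$; GAS (globally asymptotically stable) if it is GUS and $\lim_{t\to+\infty}x(t)=0$ for all $(x,\sigma)\in\mathcal{T}$. F-weak Lyapunov pair: $(V,W)$ is an F-weak Lyapunov pair for $\mathcal{T}$ if: (1) $V\in\mathcal{V}$, $0\in\mathcal{O}$ and there exist functions $\alpha_1,\alpha_2$ of class $\mathcal{K}$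 (with domains containing the values $|\xi|$ involved) such that $\alpha_1(|\xi|)\le V(\xi,\gamma)\le\alpha_2(|\xi|)$ for all $\xi\in\mathcal{O}_\gamma$, $\gamma\in\Gamma$; (2) $W:\mathrm{dom}(f)\cap(\mathcal{O}\times\Gamma)\to\mathbb{R}$ satisfies, with $W_\gamma(\cdot)=W(\cdot,\gamma)$, $-\nabla V_\gamma(\xi)f_\gamma(\xi)\ge W_\gamma(\xi)\ge0$ for all $\xi\in\mathcal{O}_\gamma$, $\gamma\in\Gamma$; (3) for every $(x,\sigma)\in\mathcal{T}$, if $x(t)\in\mathcal{O}$ for all $t\in[a,b]\subset[0,+\infty)$ then for every $\gamma\in\Gamma$, $v(t)=V(x(t),\gamma)$ is nonincreasing on $[a,b]\cap\sigma^{-1}(\gamma)$. $V$ is radially unbounded if the inequality in (1) holds for some $\alpha_1,\alpha_2$ of class $\mathcal{K}_\infty$. *)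

theory Defs
  imports "HOL-Analysis.Analysis"
begin

text \<open>
  Partial maps such as \<open>f : dom(f) \<rightarrow> \<real>\<^sup>n\<close>, \<open>V : dom(V) \<rightarrow> \<real>\<close>
  or \<open>x : I \<rightarrow> \<real>\<^sup>n\<close> are total functions that come with a separate domain argument
  (\<open>domf\<close>, \<open>domV\<close>, \<open>I\<close>); the values outside that domain are never used.  The index
  space \<open>\<Gamma>\<close> is a subset of a metric type.
\<close>

definition jumps :: "(real \<Rightarrow> 'g::metric_space) \<Rightarrow> real set" where
  "jumps \<sigma> = {t. \<not> isCont \<sigma> t}"

definition switching_signal :: "'g::metric_space set \<Rightarrow> (real \<Rightarrow> 'g) \<Rightarrow> bool" where
  "switching_signal \<Gamma> \<sigma> \<longleftrightarrow>
     range \<sigma> \<subseteq> \<Gamma> \<and>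
     (\<forall>a b. finite (jumps \<sigma> \<inter> {a..b})) \<and>
     (\<forall>a b. {a<..<b} \<inter> jumps \<sigma> = {} \<longrightarrow> \<sigma> constant_on {a<..<b}) \<and>
     (\<forall>t. continuous (at_right t) \<sigma>)"

definition S_dwell_on :: "'g::metric_space set \<Rightarrow> real \<Rightarrow> (real \<Rightarrow> 'g) set" where
  "S_dwell_on \<Gamma> \<tau>\<^sub>D = {\<sigma>. switching_signal \<Gamma> \<sigma> \<and>
     (\<forall>t\<in>jumps \<sigma>. \<forall>t'\<in>jumps \<sigma>. t \<noteq> t' \<longrightarrow> \<tau>\<^sub>D \<le> \<bar>t - t'\<bar>)}"

definition S_dwell :: "'g::metric_space set \<Rightarrow> (real \<Rightarrow> 'g) set" where
  "S_dwell \<Gamma> = (\<Union>\<tau>\<^sub>D\<in>{0<..}. S_dwell_on \<Gamma> \<tau>\<^sub>D)"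

definition S_erg_on :: "'g::metric_space set \<Rightarrow> real \<Rightarrow> (real \<Rightarrow> 'g) set" where
  "S_erg_on \<Gamma> T = {\<sigma>. switching_signal \<Gamma> \<sigma> \<and>
     (\<forall>t\<^sub>0\<ge>0. \<forall>\<gamma>\<in>\<Gamma>. \<sigma> -` {\<gamma>} \<inter> {t\<^sub>0..t\<^sub>0 + T} \<noteq> {})}"

definition S_erg :: "'g::metric_space set \<Rightarrow> (real \<Rightarrow> 'g) set" where
  "S_erg \<Gamma> = (\<Union>T\<in>{0<..}. S_erg_on \<Gamma> T)"

text \<open>The usual \<open>\<epsilon>\<close>-\<open>\<delta>\<close> definition; \<open>[a\<^sub>i, b\<^sub>i]\<close>, \<open>i < k\<close>,
  is a finite family of non-overlapping subintervals of \<open>S\<close>.\<close>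

definition absolutely_continuous_fun :: "real set \<Rightarrow> (real \<Rightarrow> 'a::real_normed_vector) \<Rightarrow> bool" where
  "absolutely_continuous_fun S x \<longleftrightarrow>
     (\<forall>\<epsilon>>0. \<exists>\<delta>>0. \<forall>(k::nat) a b.
        (\<forall>i<k. a i \<le> b i \<and> {a i..b i} \<subseteq> S) \<longrightarrow>
        (\<forall>i<k. \<forall>j<k. i \<noteq> j \<longrightarrow> {a i<..<b i} \<inter> {a j<..<b j} = {}) \<longrightarrow>
        (\<Sum>i<k. b i - a i) < \<delta> \<longrightarrow>
        (\<Sum>i<k. norm (x (b i) - x (a i))) < \<epsilon>)"

definition locally_absolutely_continuous :: "real set \<Rightarrow> (real \<Rightarrow> 'a::real_normed_vector) \<Rightarrow> bool" where
  "locally_absolutely_continuous I x \<longleftrightarrow>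
     (\<forall>a b. {a..b} \<subseteq> I \<longrightarrow> absolutely_continuous_fun {a..b} x)"

definition ode_solution ::
  "real set \<Rightarrow> (real \<Rightarrow> 'a \<Rightarrow> 'a::real_normed_vector) \<Rightarrow> (real \<Rightarrow> 'a) \<Rightarrow> bool" where
  "ode_solution I F x \<longleftrightarrow>
     is_interval I \<and> I \<noteq> {} \<and> locally_absolutely_continuous I x \<and>
     (AE t in lebesgue. t \<in> I \<longrightarrow> (x has_vector_derivative F t (x t)) (at t within I))"

text \<open>A trajectory \<open>(x, \<sigma>)\<close> is stored together with the interval of definition of \<open>x\<close>.\<close>

type_synonym ('a, 'g) traj = "real set \<times> (real \<Rightarrow> 'a) \<times> (real \<Rightarrow> 'g)"

definition trajectory ::
  "'g::metric_space set \<Rightarrow> ('a::real_normed_vector \<times> 'g) set \<Rightarrow> ('a \<times> 'g \<Rightarrow> 'a) \<Rightarrow> ('a, 'g) traj \<Rightarrow> bool" where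
  "trajectory \<Gamma> domf f = (\<lambda>(I, x, \<sigma>).
     switching_signal \<Gamma> \<sigma> \<and>
     (\<forall>t\<in>I. (x t, \<sigma> t) \<in> domf) \<and>
     ode_solution I (\<lambda>t \<xi>. f (\<xi>, \<sigma> t)) x)"

definition forward_complete :: "('a, 'g) traj \<Rightarrow> bool" where
  "forward_complete = (\<lambda>(I, x, \<sigma>). {0..} \<subseteq> I)"

text \<open>The extended real \<open>r\<close> allows for the domain \<open>[0, \<infinity>)\<close>.\<close>

definition class_K :: "ereal \<Rightarrow> (real \<Rightarrow> real) \<Rightarrow> bool" where
  "class_K r \<alpha> \<longleftrightarrow>
     0 < r \<and> \<alpha> 0 = 0 \<and>
     strict_mono_on {s. 0 \<le> s \<and> ereal s \<le> r} \<alpha> \<and>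
     continuous_on {s. 0 \<le> s \<and> ereal s \<le> r} \<alpha>"

definition class_K_inf :: "(real \<Rightarrow> real) \<Rightarrow> bool" where
  "class_K_inf \<alpha> \<longleftrightarrow> class_K \<infinity> \<alpha> \<and> \<not> bounded (\<alpha> ` {0..})"

definition LUS :: "('a::real_normed_vector, 'g) traj set \<Rightarrow> bool" where
  "LUS \<T> \<longleftrightarrow> (\<exists>r>0. \<exists>\<alpha>. class_K (ereal r) \<alpha> \<and>
     (\<forall>(I, x, \<sigma>)\<in>\<T>. \<forall>t\<^sub>0\<ge>0. norm (x t\<^sub>0) \<le> r \<longrightarrow> (\<forall>t\<ge>t\<^sub>0. norm (x t) \<le> \<alpha> (norm (x t\<^sub>0)))))"

definition GUS :: "('a::real_normed_vector, 'g) traj set \<Rightarrow> bool" where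
  "GUS \<T> \<longleftrightarrow> (\<exists>\<alpha>. class_K_inf \<alpha> \<and>
     (\<forall>(I, x, \<sigma>)\<in>\<T>. \<forall>t\<^sub>0\<ge>0. \<forall>t\<ge>t\<^sub>0. norm (x t) \<le> \<alpha> (norm (x t\<^sub>0))))"

definition LAS :: "('a::real_normed_vector, 'g) traj set \<Rightarrow> bool" where
  "LAS \<T> \<longleftrightarrow> LUS \<T> \<and>
     (\<exists>\<eta>>0. \<forall>(I, x, \<sigma>)\<in>\<T>. norm (x 0) < \<eta> \<longrightarrow> (x \<longlongrightarrow> 0) at_top)"

definition GAS :: "('a::real_normed_vector, 'g) traj set \<Rightarrow> bool" where
  "GAS \<T> \<longleftrightarrow> GUS \<T> \<and> (\<forall>(I, x, \<sigma>)\<in>\<T>. (x \<longlongrightarrow> 0) at_top)"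

definition obs_fwd_on ::
  "'a::real_normed_vector set \<Rightarrow> ('a \<Rightarrow> 'a) \<Rightarrow> ('a \<Rightarrow> real) \<Rightarrow> real \<Rightarrow> 'a set" where
  "obs_fwd_on X g h \<tau> = {\<xi>\<in>X. \<exists>\<phi>. ode_solution {0..\<tau>} (\<lambda>t. g) \<phi> \<and> \<phi> ` {0..\<tau>} \<subseteq> X \<and>
     \<phi> 0 = \<xi> \<and> (\<forall>t\<in>{0..\<tau>}. h (\<phi> t) = 0)}"

definition obs_bwd_on ::
  "'a::real_normed_vector set \<Rightarrow> ('a \<Rightarrow> 'a) \<Rightarrow> ('a \<Rightarrow> real) \<Rightarrow> real \<Rightarrow> 'a set" where
  "obs_bwd_on X g h \<tau> = {\<xi>\<in>X. \<exists>\<phi>. ode_solution {-\<tau>..0} (\<lambda>t. g) \<phi> \<and> \<phi> ` {-\<tau>..0} \<subseteq> X \<and>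
     \<phi> 0 = \<xi> \<and> (\<forall>t\<in>{-\<tau>..0}. h (\<phi> t) = 0)}"

definition obs_fwd :: "'a::real_normed_vector set \<Rightarrow> ('a \<Rightarrow> 'a) \<Rightarrow> ('a \<Rightarrow> real) \<Rightarrow> 'a set" where
  "obs_fwd X g h = (\<Union>\<tau>\<in>{0<..}. obs_fwd_on X g h \<tau>)"

definition obs_bwd :: "'a::real_normed_vector set \<Rightarrow> ('a \<Rightarrow> 'a) \<Rightarrow> ('a \<Rightarrow> real) \<Rightarrow> 'a set" where
  "obs_bwd X g h = (\<Union>\<tau>\<in>{0<..}. obs_bwd_on X g h \<tau>)"

text \<open>\<open>section_at domf \<gamma>\<close> is \<open>\<chi>\<^sub>\<gamma>\<close>, \<open>section_at domV \<gamma>\<close> is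
  \<open>\<D>\<^sub>\<gamma>\<close>, \<open>fst ` domV\<close> is \<open>\<O>\<close>, and \<open>O_at domf domV \<gamma>\<close> is
  \<open>\<O>\<^sub>\<gamma>\<close>.\<close>

definition section_at :: "('a \<times> 'g) set \<Rightarrow> 'g \<Rightarrow> 'a set" where
  "section_at A \<gamma> = {\<xi>. (\<xi>, \<gamma>) \<in> A}"

definition O_at :: "('a \<times> 'g) set \<Rightarrow> ('a \<times> 'g) set \<Rightarrow> 'g \<Rightarrow> 'a set" where
  "O_at domf domV \<gamma> = fst ` domV \<inter> section_at domf \<gamma>"

definition equilibria :: "('a::real_normed_vector \<times> 'g) set \<Rightarrow> ('a \<times> 'g \<Rightarrow> 'a) \<Rightarrow> 'g \<Rightarrow> 'a set" where
  "equilibria domf f \<gamma> = {\<xi> \<in> section_at domf \<gamma>. f (\<xi>, \<gamma>) = 0}"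

definition class_V ::
  "'g set \<Rightarrow> ('a::real_normed_vector \<times> 'g) set \<Rightarrow> ('a \<times> 'g) set \<Rightarrow> ('a \<times> 'g \<Rightarrow> real) \<Rightarrow> bool" where
  "class_V \<Gamma> domf domV V \<longleftrightarrow>
     domV \<subseteq> UNIV \<times> \<Gamma> \<and>
     (\<forall>\<gamma>\<in>\<Gamma>. open (section_at domV \<gamma>)) \<and>
     (\<forall>\<gamma>\<in>\<Gamma>. O_at domf domV \<gamma> \<subseteq> section_at domV \<gamma>) \<and>
     (\<forall>\<gamma>\<in>\<Gamma>. \<forall>\<xi>\<in>O_at domf domV \<gamma>. (\<lambda>\<zeta>. V (\<zeta>, \<gamma>)) differentiable (at \<xi>))"

text \<open>Used only at points of \<open>\<O>\<^sub>\<gamma>\<close>, where \<open>V\<^sub>\<gamma>\<close> is differentiable and so the gradient is unique.\<close>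

definition gradient :: "('a::real_inner \<Rightarrow> real) \<Rightarrow> 'a \<Rightarrow> 'a" where
  "gradient U \<xi> = (THE D. GDERIV U \<xi> :> D)"

definition F_weak_Lyapunov_pair ::
  "'g::metric_space set \<Rightarrow> ('a::real_inner \<times> 'g) set \<Rightarrow> ('a \<times> 'g \<Rightarrow> 'a) \<Rightarrow> ('a, 'g) traj set \<Rightarrow>
   ('a \<times> 'g) set \<Rightarrow> ('a \<times> 'g \<Rightarrow> real) \<Rightarrow> ('a \<times> 'g \<Rightarrow> real) \<Rightarrow> bool" where
  "F_weak_Lyapunov_pair \<Gamma> domf f \<T> domV V W \<longleftrightarrow>
     class_V \<Gamma> domf domV V \<and> 0 \<in> fst ` domV \<and>
     (\<exists>r\<^sub>1 r\<^sub>2 \<alpha>\<^sub>1 \<alpha>\<^sub>2. class_K r\<^sub>1 \<alpha>\<^sub>1 \<and> class_K r\<^sub>2 \<alpha>\<^sub>2 \<and>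
        (\<forall>\<gamma>\<in>\<Gamma>. \<forall>\<xi>\<in>O_at domf domV \<gamma>.
           ereal (norm \<xi>) \<le> r\<^sub>1 \<and> ereal (norm \<xi>) \<le> r\<^sub>2 \<and>
           \<alpha>\<^sub>1 (norm \<xi>) \<le> V (\<xi>, \<gamma>) \<and> V (\<xi>, \<gamma>) \<le> \<alpha>\<^sub>2 (norm \<xi>))) \<and>
     (\<forall>\<gamma>\<in>\<Gamma>. \<forall>\<xi>\<in>O_at domf domV \<gamma>.
        - inner (gradient (\<lambda>\<zeta>. V (\<zeta>, \<gamma>)) \<xi>) (f (\<xi>, \<gamma>)) \<ge> W (\<xi>, \<gamma>) \<and> W (\<xi>, \<gamma>) \<ge> 0) \<and>
     (\<forall>(I, x, \<sigma>)\<in>\<T>. \<forall>a b. 0 \<le> a \<longrightarrow> a \<le> b \<longrightarrow> (\<forall>t\<in>{a..b}. x t \<in> fst ` domV) \<longrightarrow>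
        (\<forall>\<gamma>\<in>\<Gamma>. antimono_on ({a..b} \<inter> \<sigma> -` {\<gamma>}) (\<lambda>t. V (x t, \<gamma>))))"

definition radially_unbounded ::
  "'g set \<Rightarrow> ('a::real_normed_vector \<times> 'g) set \<Rightarrow> ('a \<times> 'g) set \<Rightarrow> ('a \<times> 'g \<Rightarrow> real) \<Rightarrow> bool" where
  "radially_unbounded \<Gamma> domf domV V \<longleftrightarrow>
     (\<exists>\<alpha>\<^sub>1 \<alpha>\<^sub>2. class_K_inf \<alpha>\<^sub>1 \<and> class_K_inf \<alpha>\<^sub>2 \<and>
        (\<forall>\<gamma>\<in>\<Gamma>. \<forall>\<xi>\<in>O_at domf domV \<gamma>.
           \<alpha>\<^sub>1 (norm \<xi>) \<le> V (\<xi>, \<gamma>) \<and> V (\<xi>, \<gamma>) \<le> \<alpha>\<^sub>2 (norm \<xi>)))"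

end

theory Submission
  imports Defs "HOL-Complex_Analysis.Great_Picard"
begin

text \<open>
  Stability: along a mode the Lyapunov function cannot increase, so while a mode is active the norm is
  bounded by \<open>h\<close> applied to its value at the first activation, where \<open>h\<close> dominates
  \<open>\<alpha>\<^sub>1\<inverse> \<circ> \<alpha>\<^sub>2\<close>; since at most \<open>card \<Gamma>\<close> modes are entered for the first time,
  \<open>h ^^ card \<Gamma>\<close> bounds the whole trajectory.

  Attractivity: on a trajectory that stays in a compact subset of \<open>\<O>\<close>, \<open>V\<^sub>\<gamma>\<close> converges along the times of mode
  \<open>\<gamma>\<close>.  By the dwell time, every time lies in a window of fixed length with constant mode, and limits
  of the trajectory on such windows drifting to infinity are solutions on which \<open>V\<^sub>\<gamma>\<close> is constant, hence
  \<open>W\<^sub>\<gamma> = 0\<close>, hence by observability \<open>f\<^sub>\<gamma> = 0\<close>.  So the speed tends to zero; by ergodicity every mode is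
  active within bounded time of any given time, and each cluster point is an equilibrium of all modes.
\<close>

section \<open>Absolutely continuous curves\<close>

text \<open>Switching to another mode may raise \<open>V\<close>, so there is no single decreasing
  energy but one limit value per mode. Moreover \<open>V\<close> is only pointwise differentiable
  and \<open>W\<close> carries no continuity, so neither gradients nor \<open>W\<close> can be
  passed to a limit along the trajectory. Only \<open>V\<close> itself is: it is constant on a limit
  curve, and the chain rule applied to that curve gives \<open>0 \<le> W \<le> 0\<close> there.
  Solutions have a derivative only almost everywhere. The working tool is the mean value inequality
  with a free vector \<open>c\<close>: \<open>c = 0\<close> yields the common Lipschitz constant for
  Arzela-Ascoli and the smallness of displacements, while \<open>c = g (y t)\<close> yields
  differentiability of the limit curve. An interior point of a limit window has both a past and a
  future on the curve, which is why backward or forward observability serves equally well, mode by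
  mode. The bounds on \<open>V\<close> may live on a finite interval \<open>[0, r]\<close>. They are
  extended to class \<open>class_K_inf\<close> so that gains can be inverted and iterated, and the
  constants in the local estimate keep norms where the extension agrees with the original.\<close>

lemma absolutely_continuous_funD:
  assumes "absolutely_continuous_fun S x" and "0 < e"
  obtains d where "d > 0" and "\<And>(k::nat) u v.
        (\<forall>i<k. u i \<le> v i \<and> {u i..v i} \<subseteq> S) \<Longrightarrow>
        (\<forall>i<k. \<forall>j<k. i \<noteq> j \<longrightarrow> {u i<..<v i} \<inter> {u j<..<v j} = {}) \<Longrightarrow>
        (\<Sum>i<k. v i - u i) < d \<Longrightarrow> (\<Sum>i<k. norm (x (v i) - x (u i))) < e"
proof -
  have "\<exists>d>0. \<forall>(k::nat) u v.
        (\<forall>i<k. u i \<le> v i \<and> {u i..v i} \<subseteq> S) \<longrightarrow>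
        (\<forall>i<k. \<forall>j<k. i \<noteq> j \<longrightarrow> {u i<..<v i} \<inter> {u j<..<v j} = {}) \<longrightarrow>
        (\<Sum>i<k. v i - u i) < d \<longrightarrow> (\<Sum>i<k. norm (x (v i) - x (u i))) < e"
    using assms unfolding absolutely_continuous_fun_def by (elim allE[of _ e] impE)
  then show thesis
    by (elim exE conjE) (rule that, assumption, simp only: simp_thms)
qed

lemma absolutely_continuous_fun_imp_continuous_on:
  fixes x :: "real \<Rightarrow> 'a::real_normed_vector"
  assumes ac: "absolutely_continuous_fun {a..b} x"
  shows "continuous_on {a..b} x"
  unfolding continuous_on_iff
proof (intro ballI allI impI)
  fix s and e :: real assume s: "s \<in> {a..b}" and e: "0 < e"
  obtain d where d: "d > 0" and ac': "\<And>(k::nat) u v.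
        (\<forall>i<k. u i \<le> v i \<and> {u i..v i} \<subseteq> {a..b}) \<Longrightarrow>
        (\<forall>i<k. \<forall>j<k. i \<noteq> j \<longrightarrow> {u i<..<v i} \<inter> {u j<..<v j} = {}) \<Longrightarrow>
        (\<Sum>i<k. v i - u i) < d \<Longrightarrow> (\<Sum>i<k. norm (x (v i) - x (u i))) < e"
    by (rule absolutely_continuous_funD[OF ac e]) blast
  have "dist (x t) (x s) < e" if t: "t \<in> {a..b}" "dist t s < d" for t
    using ac'[of 1 "\<lambda>_. min s t" "\<lambda>_. max s t"] s t
    by (cases "s \<le> t") (auto simp: dist_norm norm_minus_commute min_def max_def)
  then show "\<exists>d>0. \<forall>t\<in>{a..b}. dist t s < d \<longrightarrow> dist (x t) (x s) < e"
    using d by blast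
qed

text \<open>Cells of a tagged division meet only in null sets, so their lengths add up to the
  measure of their union. In use, \<open>P\<close> collects the cells tagged in an exceptional null
  set and \<open>U\<close> is a thin open set around it.\<close>

lemma sum_lengths_le_measure:
  fixes P :: "(real \<times> real set) set"
  assumes p: "p tagged_division_of {a..b}" and P: "P \<subseteq> p"
    and U: "U \<in> lmeasurable" and sub: "\<And>t K. (t, K) \<in> P \<Longrightarrow> K \<subseteq> U"
  shows "(\<Sum>(t, K)\<in>P. Sup K - Inf K) \<le> measure lebesgue U"
proof -
  have fin: "finite P" using p P finite_subset by blast
  have K: "\<exists>u v. K = {u..v} \<and> u \<le> v" if "(t, K) \<in> P" for t K
  proof -
    have "\<exists>u v. K = cbox u v" "t \<in> K" using p P that by blast+
    then show ?thesis by force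
  qed
  have meas: "snd q \<in> lmeasurable" if "q \<in> P" for q
    using K[of "fst q" "snd q"] that by auto
  have "(\<Sum>(t, K)\<in>P. Sup K - Inf K) = (\<Sum>q\<in>P. measure lebesgue (snd q))"
    by (rule sum.cong) (use K in fastforce)+
  also have "\<dots> = measure lebesgue (\<Union>(snd ` P))"
  proof (rule measure_negligible_finite_Union_image[symmetric, OF fin meas])
    show "pairwise (\<lambda>q q'. negligible (snd q \<inter> snd q')) P"
    proof (rule pairwiseI)
      fix q q' assume q: "q \<in> P" "q' \<in> P" "q \<noteq> q'"
      obtain t K t' K' where [simp]: "q = (t, K)" "q' = (t', K')" by fastforce
      have "interior (K \<inter> K') = {}"
        using tagged_division_ofD(5)[OF p, of t K t' K'] q P by auto
      moreover have "convex K" "convex K'" using K q by auto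
      ultimately show "negligible (snd q \<inter> snd q')"
        by (simp add: negligible_convex_interior convex_Int)
    qed
  qed
  also have "\<dots> \<le> measure lebesgue U"
  proof (rule measure_mono_fmeasurable[OF _ _ U])
    show "\<Union> (snd ` P) \<subseteq> U" using sub by fastforce
    show "\<Union> (snd ` P) \<in> sets lebesgue"
      using meas fin by (blast intro: sets.finite_UN fmeasurableD)
  qed
  finally show ?thesis .
qed

text \<open>Off the exceptional null set the derivative controls the increments of a fine tagged division;
  the tags inside the null set only carry intervals of small total length, where absolute
  continuity applies.\<close>

lemma absolutely_continuous_mean_value:
  fixes x :: "real \<Rightarrow> 'a::real_normed_vector"
  assumes ab: "a \<le> b" and M: "0 \<le> M" and ac: "absolutely_continuous_fun {a..b} x"
    and deriv: "AE t in lebesgue. t \<in> {a..b} \<longrightarrow>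
      (\<exists>D. (x has_vector_derivative D) (at t within {a..b}) \<and> norm (D - c) \<le> M)"
  shows "norm (x b - x a - (b - a) *\<^sub>R c) \<le> M * (b - a)"
proof -
  define N where "N = {t \<in> {a..b}. \<not> (\<exists>D. (x has_vector_derivative D) (at t within {a..b}) \<and> norm (D - c) \<le> M)}"
  have N: "N \<in> null_sets lebesgue"
  proof -
    obtain N' where N': "\<And>t. t \<in> space lebesgue - N' \<Longrightarrow> t \<in> {a..b} \<longrightarrow>
      (\<exists>D. (x has_vector_derivative D) (at t within {a..b}) \<and> norm (D - c) \<le> M)"
      and "N' \<in> null_sets lebesgue"
      using AE_E3[OF deriv] by blast
    moreover have "N \<subseteq> N'" using N' by (auto simp: N_def)
    ultimately show ?thesis by (metis negligible_iff_null_sets negligible_subset)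
  qed
  \<comment> \<open>The error terms are \<open>e\<close> for the variation over the bad cells,
    \<open>e * norm c\<close> for their total length, and \<open>e * (b - a)\<close> for the
    differentiability error on the other cells.\<close>
  have key: "norm (x b - x a - (b - a) *\<^sub>R c) \<le> M * (b - a) + e * (1 + norm c + (b - a))" if e: "e > 0" for e
  proof -
    obtain d where d: "d > 0" and ac': "\<And>(k::nat) u v.
        (\<forall>i<k. u i \<le> v i \<and> {u i..v i} \<subseteq> {a..b}) \<Longrightarrow>
        (\<forall>i<k. \<forall>j<k. i \<noteq> j \<longrightarrow> {u i<..<v i} \<inter> {u j<..<v j} = {}) \<Longrightarrow>
        (\<Sum>i<k. v i - u i) < d \<Longrightarrow> (\<Sum>i<k. norm (x (v i) - x (u i))) < e"
    by (rule absolutely_continuous_funD[OF ac e]) blast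
    \<comment> \<open>A total length below \<open>d\<close> brings absolute continuity into play;
      below \<open>e\<close> it makes the drift term with factor \<open>norm c\<close>
      small.\<close>
    have "min d e > 0" using d e by simp
    then obtain U where U: "open U" "N \<subseteq> U" "U - N \<in> lmeasurable"
        "emeasure lebesgue (U - N) < ennreal (min d e)"
      using sets_lebesgue_outer_open N by blast
    have Um: "U \<in> lmeasurable"
    proof -
      have "(U - N) \<union> N \<in> lmeasurable"
        using N U(3) by (intro fmeasurable.Un) (auto simp: negligible_iff_measure negligible_iff_null_sets[symmetric])
      then show ?thesis using U(2) by (simp add: Un_absorb2)
    qed
    have "measure lebesgue U = measure lebesgue (U - N)"
      using Um N by (simp add: measure_Diff_null_set fmeasurableD)
    also have "\<dots> < min d e"
      using U(3,4) \<open>min d e > 0\<close> by (simp add: emeasure_eq_measure2 ennreal_less_iff)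
    finally have Ud: "measure lebesgue U < min d e" .
    \<comment> \<open>At a good tag the derivative controls increments over
      \<open>u \<le> t \<le> v\<close>, because the errors measured from \<open>t\<close> add up to
      \<open>e * (v - u)\<close>. At a tag in \<open>N\<close> the radius only has to fit inside
      \<open>U\<close>.\<close>
    have "\<exists>r>0. (t \<in> N \<longrightarrow> ball t r \<subseteq> U) \<and>
       (t \<in> {a..b} - N \<longrightarrow> (\<forall>u v. u \<in> ball t r \<inter> {a..b} \<longrightarrow> v \<in> ball t r \<inter> {a..b} \<longrightarrow> u \<le> t \<longrightarrow> t \<le> v \<longrightarrow>
          norm (x v - x u - (v - u) *\<^sub>R c) \<le> (M + e) * (v - u)))" for t
    proof (cases "t \<in> {a..b} - N")
      case True
      then obtain D where D: "(x has_vector_derivative D) (at t within {a..b})" "norm (D - c) \<le> M"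
        by (auto simp: N_def)
      obtain r where r: "r > 0" "\<And>s. s \<in> {a..b} \<Longrightarrow> norm (s - t) < r \<Longrightarrow>
          norm (x s - x t - (s - t) *\<^sub>R D) \<le> e * norm (s - t)"
        using D(1) e unfolding has_vector_derivative_def has_derivative_within_alt by meson
      have "norm (x v - x u - (v - u) *\<^sub>R c) \<le> (M + e) * (v - u)"
        if uv: "u \<in> ball t r \<inter> {a..b}" "v \<in> ball t r \<inter> {a..b}" "u \<le> t" "t \<le> v" for u v
      proof -
        have 1: "norm (x u - x t - (u - t) *\<^sub>R D) \<le> e * (t - u)"
          using r(2)[of u] uv by (auto simp: dist_real_def)
        have 2: "norm (x v - x t - (v - t) *\<^sub>R D) \<le> e * (v - t)"
          using r(2)[of v] uv by (auto simp: dist_real_def)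
        have "x v - x u - (v - u) *\<^sub>R c = (x v - x t - (v - t) *\<^sub>R D) - (x u - x t - (u - t) *\<^sub>R D)
           + (v - u) *\<^sub>R (D - c)"
          by (simp add: algebra_simps)
        also have "norm \<dots> \<le> e * (v - t) + e * (t - u) + (v - u) * M"
        proof (rule order_trans[OF norm_triangle_ineq add_mono])
          show "norm (x v - x t - (v - t) *\<^sub>R D - (x u - x t - (u - t) *\<^sub>R D)) \<le> e * (v - t) + e * (t - u)"
            by (rule order_trans[OF norm_triangle_ineq4 add_mono[OF 2 1]])
          show "norm ((v - u) *\<^sub>R (D - c)) \<le> (v - u) * M"
            using D(2) uv by (simp add: mult_left_mono)
        qed
        finally show ?thesis by (simp add: algebra_simps)
      qed
      with r(1) True show ?thesis by blast
    next
      case False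
      show ?thesis
      proof (cases "t \<in> N")
        case True
        then have "\<exists>r>0. ball t r \<subseteq> U" using U openE by blast
        then show ?thesis using False by blast
      qed (use False zero_less_one in blast)
    qed
    then obtain r where r: "\<And>t. r t > 0" "\<And>t. t \<in> N \<Longrightarrow> ball t (r t) \<subseteq> U"
      "\<And>t u v. t \<in> {a..b} - N \<Longrightarrow> u \<in> ball t (r t) \<inter> {a..b} \<Longrightarrow> v \<in> ball t (r t) \<inter> {a..b}
        \<Longrightarrow> u \<le> t \<Longrightarrow> t \<le> v \<Longrightarrow> norm (x v - x u - (v - u) *\<^sub>R c) \<le> (M + e) * (v - u)"
      by metis
    have "gauge (\<lambda>t. ball t (r t))" using r(1) by (simp add: gauge_def)
    then obtain p where p: "p tagged_division_of {a..b}" "(\<lambda>t. ball t (r t)) fine p"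
      using fine_division_exists_real by blast
    have fin: "finite p" using p by blast
    have K: "\<exists>u v. K = {u..v} \<and> u \<le> t \<and> t \<le> v \<and> a \<le> u \<and> v \<le> b \<and> {u..v} \<subseteq> ball t (r t)" if "(t, K) \<in> p" for t K
    proof -
      have "\<exists>u v. K = cbox u v" "t \<in> K" "K \<subseteq> {a..b}" "K \<subseteq> ball t (r t)"
        using p that by (blast, blast, blast, auto simp: fine_def)
      then show ?thesis by force
    qed
    \<comment> \<open>Subtracting the drift turns the claim into a bound on one increment of
      \<open>z\<close>, which telescopes over the division.\<close>
    define z where "z s = x s - s *\<^sub>R c" for s
    have z: "z v - z u = x v - x u - (v - u) *\<^sub>R c" for u v
      by (simp add: z_def algebra_simps)
    define P where "P = {q \<in> p. fst q \<in> N}"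
    have Pp: "P \<subseteq> p" by (auto simp: P_def)
    have finP: "finite P" using fin Pp finite_subset by blast
    have len: "(\<Sum>(t, K)\<in>P. Sup K - Inf K) < min d e"
    proof (rule le_less_trans[OF sum_lengths_le_measure[OF p(1) Pp Um] Ud])
      fix t K assume "(t, K) \<in> P" then show "K \<subseteq> U"
        using K[of t K] r(2)[of t] by (auto simp: P_def)
    qed
    have len1: "(\<Sum>(t, K)\<in>p - P. Sup K - Inf K) \<le> b - a"
    proof -
      have "(\<Sum>(t, K)\<in>p - P. Sup K - Inf K) \<le> (\<Sum>(t, K)\<in>p. Sup K - Inf K)"
        by (rule sum_mono2[OF fin]) (use K in fastforce)+
      also have "\<dots> = b - a"
        using additive_tagged_division_1[OF ab p(1), of "\<lambda>s. s"] by simp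
      finally show ?thesis .
    qed
    have xP: "(\<Sum>(t, K)\<in>P. norm (x (Sup K) - x (Inf K))) < e"
    proof -
      \<comment> \<open>Absolute continuity speaks of families indexed by an initial segment of the
        naturals, so the cells in \<open>P\<close> are enumerated.\<close>
      obtain q where q: "bij_betw q {..<card P} P"
        using ex_bij_betw_nat_finite[OF finP] by (auto simp: atLeast0LessThan)
      let ?u = "\<lambda>i. Inf (snd (q i))" and ?v = "\<lambda>i. Sup (snd (q i))"
      have qP: "q i \<in> P" if "i < card P" for i using q that by (auto simp: bij_betw_def)
      have sums: "(\<Sum>i<card P. g (q i)) = (\<Sum>w\<in>P. g w)" for g :: "real \<times> real set \<Rightarrow> real"
        by (rule sum.reindex_bij_betw[OF q])
      have seg: "snd (q i) = {?u i..?v i} \<and> ?u i \<le> ?v i \<and> {?u i..?v i} \<subseteq> {a..b}" if "i < card P" for i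
        using K[of "fst (q i)" "snd (q i)"] qP[OF that] Pp by fastforce
      have "(\<Sum>i<card P. norm (x (?v i) - x (?u i))) < e"
      proof (rule ac')
        show "\<forall>i<card P. ?u i \<le> ?v i \<and> {?u i..?v i} \<subseteq> {a..b}" using seg by blast
        show "(\<Sum>i<card P. ?v i - ?u i) < d"
          using len sums[of "\<lambda>w. Sup (snd w) - Inf (snd w)"] by (simp add: case_prod_beta)
        show "\<forall>i<card P. \<forall>j<card P. i \<noteq> j \<longrightarrow> {?u i<..<?v i} \<inter> {?u j<..<?v j} = {}"
        proof (intro allI impI)
          fix i j assume ij: "i < card P" "j < card P" "i \<noteq> j"
          then have "q i \<noteq> q j" using q by (auto simp: bij_betw_def inj_on_def)
          then have "interior (snd (q i)) \<inter> interior (snd (q j)) = {}"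
            using tagged_division_ofD(5)[OF p(1), of "fst (q i)" "snd (q i)" "fst (q j)" "snd (q j)"]
              qP ij Pp by auto
          then show "{?u i<..<?v i} \<inter> {?u j<..<?v j} = {}"
            using seg ij by (metis interior_atLeastAtMost_real)
        qed
      qed
      then show ?thesis
        using sums[of "\<lambda>w. norm (x (Sup (snd w)) - x (Inf (snd w)))"] by (simp add: case_prod_beta)
    qed
    have "z b - z a = (\<Sum>(t, K)\<in>p. z (Sup K) - z (Inf K))"
      using additive_tagged_division_1[OF ab p(1), of z] by simp
    also have "\<dots> = (\<Sum>(t, K)\<in>p - P. z (Sup K) - z (Inf K)) + (\<Sum>(t, K)\<in>P. z (Sup K) - z (Inf K))"
      by (rule sum.subset_diff[OF Pp fin])
    also have "norm \<dots> \<le> (\<Sum>(t, K)\<in>p - P. (M + e) * (Sup K - Inf K)) +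
        (\<Sum>(t, K)\<in>P. norm (x (Sup K) - x (Inf K)) + norm c * (Sup K - Inf K))"
    proof (intro order_trans[OF norm_triangle_ineq] add_mono sum_norm_le)
      fix q assume q: "q \<in> p - P"
      obtain t w where [simp]: "q = (t, w)" by fastforce
      obtain u v where uv: "w = {u..v}" "u \<le> t" "t \<le> v" "a \<le> u" "v \<le> b" "{u..v} \<subseteq> ball t (r t)"
        using K[of t w] q by auto
      have "u \<in> ball t (r t) \<inter> {a..b}" "v \<in> ball t (r t) \<inter> {a..b}"
        using uv(1-5) subsetD[OF uv(6), of u] subsetD[OF uv(6), of v] by auto
      moreover have "t \<in> {a..b} - N" using uv q by (auto simp: P_def)
      ultimately have "norm (x v - x u - (v - u) *\<^sub>R c) \<le> (M + e) * (v - u)"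
        using r(3) uv by blast
      then show "norm (case q of (t, K) \<Rightarrow> z (Sup K) - z (Inf K)) \<le> (case q of (t, K) \<Rightarrow> (M + e) * (Sup K - Inf K))"
        using uv by (simp add: z)
    next
      fix q assume q: "q \<in> P"
      obtain t w where [simp]: "q = (t, w)" by fastforce
      obtain u v where uv: "w = {u..v}" "u \<le> t" "t \<le> v"
        using K[of t w] q Pp by auto
      have "norm (x v - x u - (v - u) *\<^sub>R c) \<le> norm (x v - x u) + norm ((v - u) *\<^sub>R c)"
        by (rule norm_triangle_ineq4)
      then show "norm (case q of (t, K) \<Rightarrow> z (Sup K) - z (Inf K)) \<le>
         (case q of (t, K) \<Rightarrow> norm (x (Sup K) - x (Inf K)) + norm c * (Sup K - Inf K))"
        using uv by (simp add: z mult.commute)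
    qed
    also have "\<dots> = (M + e) * (\<Sum>(t, K)\<in>p - P. Sup K - Inf K) +
        ((\<Sum>(t, K)\<in>P. norm (x (Sup K) - x (Inf K))) + norm c * (\<Sum>(t, K)\<in>P. Sup K - Inf K))"
      by (simp add: case_prod_beta sum.distrib sum_distrib_left)
    also have "\<dots> \<le> (M + e) * (b - a) + (e + norm c * e)"
      using len len1 xP M e by (intro add_mono mult_left_mono) auto
    finally show ?thesis by (simp add: z algebra_simps)
  qed
  have "((\<lambda>e. M * (b - a) + e * (1 + norm c + (b - a))) \<longlongrightarrow> M * (b - a) + 0 * (1 + norm c + (b - a))) (at_right 0)"
    by (intro tendsto_intros)
  then have "norm (x b - x a - (b - a) *\<^sub>R c) \<le> M * (b - a) + 0 * (1 + norm c + (b - a))"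
    by (rule tendsto_lowerbound) (auto intro: key eventually_mono[OF eventually_at_right_less])
  then show ?thesis by simp
qed

section \<open>Comparison functions\<close>

text \<open>Monotonicity from the value 0 makes \<open>\<alpha>\<close> nonnegative on the
  half-line, so it can only be unbounded upwards.\<close>

lemma class_K_inf_iff:
  "class_K_inf \<alpha> \<longleftrightarrow> \<alpha> 0 = 0 \<and> strict_mono_on {0..} \<alpha> \<and> continuous_on {0..} \<alpha> \<and>
    (\<forall>y. \<exists>s\<ge>0. y \<le> \<alpha> s)"
proof -
  have eq: "{s. 0 \<le> s \<and> ereal s \<le> \<infinity>} = {0..}" by auto
  have "\<not> bounded (\<alpha> ` {0..}) \<longleftrightarrow> (\<forall>y. \<exists>s\<ge>0. y \<le> \<alpha> s)"
    if "\<alpha> 0 = 0" "strict_mono_on {0..} \<alpha>"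
  proof -
    have nn: "0 \<le> \<alpha> s" if "0 \<le> s" for s
      using \<open>strict_mono_on {0..} \<alpha>\<close> \<open>\<alpha> 0 = 0\<close> that
      by (metis atLeast_iff order_refl strict_mono_on_leD)
    have "bounded (\<alpha> ` {0..}) \<longleftrightarrow> (\<exists>y. \<forall>s\<ge>0. \<alpha> s < y)"
    proof
      assume "bounded (\<alpha> ` {0..})"
      then obtain B where "\<And>s. 0 \<le> s \<Longrightarrow> \<bar>\<alpha> s\<bar> \<le> B" by (auto simp: bounded_iff)
      then show "\<exists>y. \<forall>s\<ge>0. \<alpha> s < y" by (intro exI[of _ "B + 1"]) fastforce
    next
      assume "\<exists>y. \<forall>s\<ge>0. \<alpha> s < y"
      then show "bounded (\<alpha> ` {0..})" using nn by (auto simp: bounded_iff intro: less_imp_le)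
    qed
    then show ?thesis by (auto simp: not_less)
  qed
  then show ?thesis
    unfolding class_K_inf_def class_K_def eq by auto
qed

lemma class_K_inf_nonneg: "class_K_inf \<alpha> \<Longrightarrow> 0 \<le> s \<Longrightarrow> 0 \<le> \<alpha> s"
  unfolding class_K_inf_iff by (metis atLeast_iff order_refl strict_mono_on_leD)

lemma class_K_inf_le_iff: "class_K_inf \<alpha> \<Longrightarrow> 0 \<le> s \<Longrightarrow> 0 \<le> t \<Longrightarrow> \<alpha> s \<le> \<alpha> t \<longleftrightarrow> s \<le> t"
  using strict_mono_on_less_eq[of "{0..}" \<alpha> s t] unfolding class_K_inf_iff by auto

lemma class_K_inf_imp_class_K: "class_K_inf \<alpha> \<Longrightarrow> 0 < r \<Longrightarrow> class_K r \<alpha>"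
  unfolding class_K_inf_def class_K_def
  by (auto intro!: strict_mono_onI dest: strict_mono_onD elim!: continuous_on_subset)

text \<open>Beyond \<open>c\<close> the graph continues along a line of slope one. A comparison
  function on a bounded interval thereby becomes one that can be inverted and iterated on all of
  \<open>{0..}\<close>.\<close>

lemma class_K_inf_extension:
  assumes "class_K r \<alpha>" and c: "0 < c" "ereal c \<le> r"
  obtains a where "class_K_inf a" "\<And>s. s \<le> c \<Longrightarrow> a s = \<alpha> s"
proof
  let ?a = "\<lambda>s. if s \<le> c then \<alpha> s else \<alpha> c + (s - c)"
  have sub: "{0..c} \<subseteq> {s. 0 \<le> s \<and> ereal s \<le> r}"
    using c by (auto intro: order_trans[of _ "ereal c"])
  have z: "\<alpha> 0 = 0" and mono: "strict_mono_on {0..c} \<alpha>" and cont: "continuous_on {0..c} \<alpha>"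
    using assms(1) sub unfolding class_K_def
    by (auto intro: monotone_on_subset continuous_on_subset)
  have "continuous_on ({0..c} \<union> {c..}) ?a"
    by (intro continuous_on_If cont closed_atLeastAtMost closed_atLeast continuous_intros) auto
  moreover have "{0..c} \<union> {c..} = {0..}" using c by auto
  moreover have "strict_mono_on {0..} ?a"
  proof (rule strict_mono_onI)
    fix s t :: real assume st: "s \<in> {0..}" "t \<in> {0..}" "s < t"
    have "\<alpha> s \<le> \<alpha> c" if "s \<le> c"
      using strict_mono_on_leD[OF mono, of s c] st that c by auto
    then show "?a s < ?a t"
      using strict_mono_onD[OF mono, of s t] st by fastforce
  qed
  moreover have "\<exists>s\<ge>0. y \<le> ?a s" for y
    by (rule exI[of _ "c + 1 + \<bar>y\<bar> + \<bar>\<alpha> c\<bar>"]) (use c in auto)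
  ultimately show "class_K_inf ?a"
    unfolding class_K_inf_iff using z c by auto
qed auto

lemma class_K_inf_inverse:
  assumes \<alpha>: "class_K_inf \<alpha>"
  obtains \<beta> where "class_K_inf \<beta>" "\<And>s. 0 \<le> s \<Longrightarrow> \<alpha> (\<beta> s) = s"
proof -
  note \<alpha>' = \<alpha>[unfolded class_K_inf_iff]
  have ex: "\<exists>s\<ge>0. \<alpha> s = y" if "0 \<le> y" for y
  proof -
    obtain t where t: "t \<ge> 0" "y \<le> \<alpha> t" using \<alpha>' by blast
    moreover have "continuous_on {0..t} \<alpha>"
      using \<alpha>' by (auto intro: continuous_on_subset)
    ultimately show ?thesis
      using IVT'[of \<alpha> 0 y t] \<alpha>' that by auto
  qed
  then obtain b where b: "\<And>y. 0 \<le> y \<Longrightarrow> 0 \<le> b y \<and> \<alpha> (b y) = y" by metis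
  have ba: "b (\<alpha> s) = s" if "0 \<le> s" for s
    using b[OF class_K_inf_nonneg[OF \<alpha> that]] class_K_inf_le_iff[OF \<alpha>, of s "b (\<alpha> s)"]
      class_K_inf_le_iff[OF \<alpha>, of "b (\<alpha> s)" s] that by auto
  have bless: "b y < b y' \<longleftrightarrow> y < y'" if "0 \<le> y" "0 \<le> y'" for y y'
    using b[OF that(1)] b[OF that(2)] class_K_inf_le_iff[OF \<alpha>, of "b y'" "b y"] by auto
  \<comment> \<open>Continued by the identity on the negative reals, the inverse is a monotone
    surjection of the whole line, and continuity follows from that alone.\<close>
  define \<beta> where "\<beta> y = (if 0 \<le> y then b y else y)" for y
  have \<beta>_less: "\<beta> y < \<beta> y'" if "y < y'" for y y'
    using that bless[of y y'] b[of y'] by (auto simp: \<beta>_def)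
  have "surj \<beta>"
  proof (rule surjI)
    show "\<beta> (if 0 \<le> s then \<alpha> s else s) = s" for s
      using ba[of s] class_K_inf_nonneg[OF \<alpha>, of s] by (simp add: \<beta>_def)
  qed
  have "continuous_on UNIV \<beta>"
  proof (rule continuous_onI_mono)
    show "\<beta> y \<le> \<beta> y'" if "y \<le> y'" for y y'
      using \<beta>_less[of y y'] that by (cases "y = y'") auto
  qed (use \<open>surj \<beta>\<close> in auto)
  have "\<exists>s\<ge>0. y \<le> \<beta> s" for y
  proof -
    have "\<beta> (\<alpha> \<bar>y\<bar>) = \<bar>y\<bar>"
      using ba class_K_inf_nonneg[OF \<alpha>] by (simp add: \<beta>_def)
    then show ?thesis
      using class_K_inf_nonneg[OF \<alpha>, of "\<bar>y\<bar>"] by (intro exI[of _ "\<alpha> \<bar>y\<bar>"]) simp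
  qed
  moreover have "\<beta> 0 = 0"
    using ba[of 0] \<alpha>' by (simp add: \<beta>_def)
  moreover have "continuous_on {0..} \<beta>"
    using \<open>continuous_on UNIV \<beta>\<close> by (rule continuous_on_subset) simp
  ultimately have "class_K_inf \<beta>"
    unfolding class_K_inf_iff using \<beta>_less by (simp add: strict_mono_on_def)
  then show thesis using that b by (simp add: \<beta>_def)
qed

lemma class_K_inf_comp:
  assumes a: "class_K_inf a" and b: "class_K_inf b"
  shows "class_K_inf (a \<circ> b)"
  unfolding class_K_inf_iff
proof (intro conjI allI)
  note a' = a[unfolded class_K_inf_iff] and b' = b[unfolded class_K_inf_iff]
  have im: "b ` {0..} \<subseteq> {0..}" using class_K_inf_nonneg[OF b] by auto
  show "(a \<circ> b) 0 = 0" using a' b' by simp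
  show "strict_mono_on {0..} (a \<circ> b)"
    using a' b' class_K_inf_nonneg[OF b] by (simp add: strict_mono_on_def)
  show "continuous_on {0..} (a \<circ> b)"
    using a' b' im by (meson continuous_on_compose continuous_on_subset)
  fix y
  obtain s where s: "s \<ge> 0" "y \<le> a s" using a' by blast
  obtain t where t: "t \<ge> 0" "s \<le> b t" using b' by blast
  have "a s \<le> a (b t)" using class_K_inf_le_iff[OF a, of s "b t"] s t by auto
  then show "\<exists>s\<ge>0. y \<le> (a \<circ> b) s" using s t by auto
qed

lemma class_K_inf_id: "class_K_inf (\<lambda>s. s)"
proof -
  have "\<exists>s\<ge>0. y \<le> s" for y :: real
    by (rule exI[of _ "\<bar>y\<bar>"]) simp
  then show ?thesis
    unfolding class_K_inf_iff by (simp add: strict_mono_on_def)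
qed

lemma class_K_inf_funpow:
  assumes "class_K_inf h"
  shows "class_K_inf (h ^^ k)"
proof (induction k)
  case 0
  show ?case using class_K_inf_id by (simp add: id_def)
next
  case (Suc k)
  show ?case using class_K_inf_comp[OF assms Suc] by (simp only: funpow.simps)
qed

lemma class_K_inf_add_id:
  assumes a: "class_K_inf a"
  shows "class_K_inf (\<lambda>s. a s + s)"
  unfolding class_K_inf_iff
proof (intro conjI allI)
  note a' = a[unfolded class_K_inf_iff]
  show "a 0 + 0 = 0" using a' by simp
  show "strict_mono_on {0..} (\<lambda>s. a s + s)"
    using a' by (simp add: strict_mono_on_def add_strict_mono)
  show "continuous_on {0..} (\<lambda>s. a s + s)"
    using a' by (intro continuous_intros) blast
  fix y
  have "y \<le> a \<bar>y\<bar> + \<bar>y\<bar>"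
    using class_K_inf_nonneg[OF a, of "\<bar>y\<bar>"] by linarith
  then show "\<exists>s\<ge>0. y \<le> a s + s" using abs_ge_zero by blast
qed

lemma class_K_inf_gain:
  assumes a1: "class_K_inf a\<^sub>1" and a2: "class_K_inf a\<^sub>2"
  obtains h where "class_K_inf h" "\<And>s. 0 \<le> s \<Longrightarrow> s \<le> h s"
    "\<And>s u. 0 \<le> s \<Longrightarrow> 0 \<le> u \<Longrightarrow> a\<^sub>1 u \<le> a\<^sub>2 s \<Longrightarrow> u \<le> h s"
proof -
  obtain b where b: "class_K_inf b" "\<And>s. 0 \<le> s \<Longrightarrow> a\<^sub>1 (b s) = s"
    using class_K_inf_inverse[OF a1] by blast
  \<comment> \<open>The inverse \<open>b\<close> solves the inequality for \<open>u\<close>; the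
    summand \<open>s\<close> forces \<open>s \<le> h s\<close>, so that iterating \<open>h\<close>
    never lowers a bound.\<close>
  let ?h = "\<lambda>s. (b \<circ> a\<^sub>2) s + s"
  note nn = class_K_inf_nonneg[OF a2] class_K_inf_nonneg[OF b(1)]
  have "u \<le> ?h s" if "0 \<le> s" "0 \<le> u" "a\<^sub>1 u \<le> a\<^sub>2 s" for s u
    using class_K_inf_le_iff[OF a1, of u "b (a\<^sub>2 s)"] b(2)[of "a\<^sub>2 s"] nn that by fastforce
  moreover have "s \<le> ?h s" if "0 \<le> s" for s
    using nn that by auto
  ultimately show thesis
    using that class_K_inf_add_id[OF class_K_inf_comp[OF b(1) a2]] by blast
qed

section \<open>Norm bounds from the number of visited modes\<close>

lemma class_K_inf_small:
  assumes a: "class_K_inf a" and e: "0 < (e::real)"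
  obtains c where "0 < c" "a c < e"
proof -
  obtain b where b: "class_K_inf b" "\<And>s. 0 \<le> s \<Longrightarrow> a (b s) = s"
    using class_K_inf_inverse[OF a] by blast
  have "b e \<noteq> 0" using b(2)[of e] e a by (auto simp: class_K_inf_iff)
  then have "0 < b e" using class_K_inf_nonneg[OF b(1), of e] e by simp
  moreover from this have "a (b e / 2) < e"
    using class_K_inf_le_iff[OF a, of "b e" "b e / 2"] b(2)[of e] e by auto
  ultimately show thesis using that[of "b e / 2"] by simp
qed

lemma le_funpow:
  fixes h :: "real \<Rightarrow> real"
  assumes h: "\<And>s. 0 \<le> s \<Longrightarrow> s \<le> h s" and r: "0 \<le> r"
  shows "r \<le> (h ^^ k) r"
proof (induction k)
  case (Suc k)
  then have "(h ^^ k) r \<le> h ((h ^^ k) r)" using r by (intro h) linarith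
  with Suc show ?case by simp
qed simp

text \<open>Right continuity makes the first time at which a mode is active belong to that mode.\<close>

lemma first_activation:
  fixes \<sigma> :: "real \<Rightarrow> 'g::t1_space"
  assumes right: "\<And>t. continuous (at_right t) \<sigma>" and t: "t\<^sub>0 \<le> t"
  obtains s where "t\<^sub>0 \<le> s" "s \<le> t" "\<sigma> s = \<sigma> t" "\<And>u. t\<^sub>0 \<le> u \<Longrightarrow> u < s \<Longrightarrow> \<sigma> u \<noteq> \<sigma> t"
proof -
  define A where "A = {u \<in> {t\<^sub>0..t}. \<sigma> u = \<sigma> t}"
  define s where "s = Inf A"
  have A: "t \<in> A" "bdd_below A" using t by (auto simp: A_def)
  have lower: "s \<le> u" if "u \<in> A" for u
    using that A unfolding s_def by (auto intro: cInf_lower)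
  have s: "t\<^sub>0 \<le> s"
    unfolding s_def using A by (intro cInf_greatest) (auto simp: A_def)
  have "\<sigma> s = \<sigma> t"
  proof (rule ccontr)
    assume ne: "\<sigma> s \<noteq> \<sigma> t"
    have "(\<sigma> \<longlongrightarrow> \<sigma> s) (at_right s)"
      using right[of s] by (simp add: continuous_within)
    then have "eventually (\<lambda>u. \<sigma> u \<noteq> \<sigma> t) (at_right s)"
      using ne by (rule tendsto_imp_eventually_ne)
    then obtain b where b: "b > s" "\<And>u. s < u \<Longrightarrow> u < b \<Longrightarrow> \<sigma> u \<noteq> \<sigma> t"
      unfolding eventually_at_right_field by blast
    have "b \<le> u" if "u \<in> A" for u
      using b(2)[of u] lower[OF that] that ne by (cases "u = s") (auto simp: A_def not_less[symmetric])
    then have "b \<le> s" unfolding s_def using A by (intro cInf_greatest) auto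
    then show False using b by simp
  qed
  moreover have "s \<le> t" using lower A by blast
  moreover have "\<sigma> u \<noteq> \<sigma> t" if "t\<^sub>0 \<le> u" "u < s" for u
    using lower[of u] that \<open>s \<le> t\<close> by (auto simp: A_def)
  ultimately show thesis using that s by blast
qed

text \<open>Each mode entered for the first time costs one application of \<open>h\<close>; re-entering a mode costs
  nothing, because the bound is inherited from the first activation.\<close>

lemma norm_bound_by_mode_count:
  fixes x :: "real \<Rightarrow> 'a::real_normed_vector" and \<sigma> :: "real \<Rightarrow> 'g::t1_space"
  assumes cont: "continuous_on {t\<^sub>0..t\<^sub>1} x" and right: "\<And>t. continuous (at_right t) \<sigma>"
    and fin: "finite (range \<sigma>)"
    and h: "class_K_inf h" "\<And>s. 0 \<le> s \<Longrightarrow> s \<le> h s"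
    and step: "\<And>s t. t\<^sub>0 \<le> s \<Longrightarrow> s \<le> t \<Longrightarrow> t \<le> t\<^sub>1 \<Longrightarrow> \<sigma> s = \<sigma> t \<Longrightarrow> norm (x s) \<le> c
      \<Longrightarrow> norm (x t) \<le> h (norm (x s))"
    and t: "t\<^sub>0 \<le> t" "t \<le> t\<^sub>1"
    and k: "card (\<sigma> ` {t\<^sub>0..t}) \<le> k" and c: "(h ^^ k) (norm (x t\<^sub>0)) \<le> c"
  shows "norm (x t) \<le> (h ^^ k) (norm (x t\<^sub>0))"
  using t k c
proof (induction k arbitrary: t)
  case 0
  have "finite (\<sigma> ` {t\<^sub>0..t})" using fin by (rule finite_subset[rotated]) auto
  then have "\<sigma> ` {t\<^sub>0..t} = {}" using 0 by (simp only: le_zero_eq card_eq_0_iff) auto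
  then show ?case using 0 by auto
next
  case (Suc k)
  let ?r = "norm (x t\<^sub>0)" and ?B = "(h ^^ k) (norm (x t\<^sub>0))"
  have B0: "0 \<le> ?B" and rB: "?r \<le> ?B"
    using class_K_inf_nonneg[OF class_K_inf_funpow[OF h(1)]] le_funpow[OF h(2)] by simp_all
  have Bc: "?B \<le> h ?B" "h ?B \<le> c" using h(2)[OF B0] Suc.prems by auto
  obtain s where s: "t\<^sub>0 \<le> s" "s \<le> t" "\<sigma> s = \<sigma> t" "\<And>u. t\<^sub>0 \<le> u \<Longrightarrow> u < s \<Longrightarrow> \<sigma> u \<noteq> \<sigma> t"
    using first_activation[OF right] Suc.prems by metis
  have "norm (x s) \<le> ?B"
  proof (cases "s = t\<^sub>0")
    case False
    then have "t\<^sub>0 < s" using s by simp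
    have "norm (x u) \<le> ?B" if u: "u \<in> {t\<^sub>0..<s}" for u
    proof (rule Suc.IH)
      \<comment> \<open>Before its first activation the mode \<open>\<sigma> t\<close> has not
        occurred, so one mode fewer is counted and the induction hypothesis applies up to, but
        excluding, \<open>s\<close>.\<close>
      have "\<sigma> ` {t\<^sub>0..u} \<subseteq> \<sigma> ` {t\<^sub>0..t} - {\<sigma> t}" using u s by fastforce
      moreover have "finite (\<sigma> ` {t\<^sub>0..t})" using fin by (rule finite_subset[rotated]) auto
      moreover have "\<sigma> t \<in> \<sigma> ` {t\<^sub>0..t}" using Suc.prems by auto
      ultimately have "card (\<sigma> ` {t\<^sub>0..u}) < card (\<sigma> ` {t\<^sub>0..t})"
        by (meson card_Diff1_less card_mono finite_Diff le_less_trans)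
      then show "card (\<sigma> ` {t\<^sub>0..u}) \<le> k" using Suc.prems by simp
    qed (use u s Suc.prems Bc in auto)
    \<comment> \<open>At \<open>s\<close> the new mode already counts; the smaller bound reaches
      \<open>s\<close> only by continuity of \<open>x\<close>.\<close>
    moreover have "closure {t\<^sub>0..<s} = {t\<^sub>0..s}" using \<open>t\<^sub>0 < s\<close> by simp
    moreover have "continuous_on {t\<^sub>0..s} x"
      using cont by (rule continuous_on_subset) (use s Suc.prems in auto)
    ultimately show ?thesis
      using continuous_on_closure_norm_le[of "{t\<^sub>0..<s}" x ?B s] s by simp
  qed (use rB in simp)
  then have "norm (x t) \<le> h (norm (x s))"
    using step[of s t] s Suc.prems Bc by auto
  also have "\<dots> \<le> h ?B"
    using \<open>norm (x s) \<le> ?B\<close> class_K_inf_le_iff[OF h(1), of "norm (x s)" ?B] B0 by simp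
  finally show ?case by simp
qed

text \<open>A first-exit argument: \<open>step\<close> is available only while the path stays in the
  ball of radius \<open>\<rho>\<close>, but the bound it yields is strictly below
  \<open>\<rho>\<close>, so the sphere is never reached.\<close>

lemma norm_bound_in_ball:
  fixes x :: "real \<Rightarrow> 'a::real_normed_vector" and \<sigma> :: "real \<Rightarrow> 'g::t1_space"
  assumes cont: "continuous_on {t\<^sub>0..} x" and right: "\<And>t. continuous (at_right t) \<sigma>"
    and fin: "finite \<Gamma>" and \<Gamma>: "range \<sigma> \<subseteq> \<Gamma>"
    and h: "class_K_inf h" "\<And>s. 0 \<le> s \<Longrightarrow> s \<le> h s"
    and step: "\<And>s t. t\<^sub>0 \<le> s \<Longrightarrow> s \<le> t \<Longrightarrow> \<sigma> s = \<sigma> t \<Longrightarrow> \<forall>u\<in>{s..t}. norm (x u) \<le> \<rho> \<Longrightarrow> norm (x s) \<le> c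
      \<Longrightarrow> norm (x t) \<le> h (norm (x s))"
    and c: "(h ^^ card \<Gamma>) (norm (x t\<^sub>0)) \<le> c" and \<rho>: "(h ^^ card \<Gamma>) (norm (x t\<^sub>0)) < \<rho>"
    and t: "t\<^sub>0 \<le> t"
  shows "norm (x t) \<le> (h ^^ card \<Gamma>) (norm (x t\<^sub>0))"
proof -
  have bound: "norm (x s) \<le> (h ^^ card \<Gamma>) (norm (x t\<^sub>0))"
    if s: "t\<^sub>0 \<le> s" "\<forall>u\<in>{t\<^sub>0..s}. norm (x u) \<le> \<rho>" for s
  proof (rule norm_bound_by_mode_count[where \<sigma> = \<sigma> and t\<^sub>1 = s and c = c])
    show "continuous_on {t\<^sub>0..s} x" using cont by (rule continuous_on_subset) auto
    show "finite (range \<sigma>)" using fin \<Gamma> by (rule finite_subset[rotated])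
    show "card (\<sigma> ` {t\<^sub>0..s}) \<le> card \<Gamma>" using fin \<Gamma> by (intro card_mono) auto
    show "norm (x u) \<le> h (norm (x w))"
      if "t\<^sub>0 \<le> w" "w \<le> u" "u \<le> s" "\<sigma> w = \<sigma> u" "norm (x w) \<le> c" for w u
      by (rule step) (use that s(2) in auto)
  qed (fact right h c s(1) order_refl)+
  have "norm (x t) \<le> \<rho>" if "t\<^sub>0 \<le> t" for t
  proof (rule ccontr)
    assume nt: "\<not> norm (x t) \<le> \<rho>"
    \<comment> \<open>\<open>Inf A\<close> is the first time at which the norm reaches
      \<open>\<rho>\<close>. Up to that time the path is still in the closed ball, so
      \<open>bound\<close> applies there and gives a contradiction.\<close>
    define A where "A = {u \<in> {t\<^sub>0..t}. \<rho> \<le> norm (x u)}"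
    have ct: "continuous_on {t\<^sub>0..t} x" using cont by (rule continuous_on_subset) auto
    then have "closed A"
      unfolding A_def
      by (rule continuous_on_closed_Collect_le[OF continuous_on_const continuous_on_norm closed_atLeastAtMost])
    moreover have "t \<in> A" "bdd_below A" using that nt by (auto simp: A_def)
    ultimately have "Inf A \<in> A" "\<And>u. u \<in> A \<Longrightarrow> Inf A \<le> u"
      using closed_contains_Inf cInf_lower by blast+
    then obtain w where w: "t\<^sub>0 \<le> w" "w \<le> t" "\<rho> \<le> norm (x w)" "\<And>u. u \<in> A \<Longrightarrow> w \<le> u"
      by (auto simp: A_def)
    have less: "norm (x u) < \<rho>" if "u \<in> {t\<^sub>0..<w}" for u
      using w(4)[of u] that w(2) by (force simp: A_def)
    have "norm (x t\<^sub>0) < \<rho>"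
      using le_funpow[OF h(2), of "norm (x t\<^sub>0)" "card \<Gamma>"] \<rho> by simp
    then have "t\<^sub>0 < w" using w by (cases "t\<^sub>0 = w") auto
    then have "closure {t\<^sub>0..<w} = {t\<^sub>0..w}" by simp
    moreover have "continuous_on {t\<^sub>0..w} x"
      using ct by (rule continuous_on_subset) (use w in auto)
    ultimately have le: "norm (x u) \<le> \<rho>" if "u \<in> {t\<^sub>0..w}" for u
      using continuous_on_closure_norm_le[of "{t\<^sub>0..<w}" x \<rho> u] that less_imp_le[OF less] by simp
    have "norm (x w) \<le> (h ^^ card \<Gamma>) (norm (x t\<^sub>0))"
      using w le by (intro bound) auto
    then show False using w \<rho> by simp
  qed
  then show ?thesis using bound t by simp
qed

section \<open>Stability\<close>

locale weak_lyapunov_family =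
  fixes \<Gamma> :: "'g::metric_space set"
    and domf :: "('a::euclidean_space \<times> 'g) set"
    and f :: "'a \<times> 'g \<Rightarrow> 'a"
    and \<T> :: "('a, 'g) traj set"
    and domV :: "('a \<times> 'g) set"
    and V W :: "'a \<times> 'g \<Rightarrow> real"
  assumes finite_modes: "finite \<Gamma>"
    and closed_domf: "closed domf" and continuous_f: "continuous_on domf f"
    and trajectories: "\<And>\<theta>. \<theta> \<in> \<T> \<Longrightarrow> trajectory \<Gamma> domf f \<theta> \<and> forward_complete \<theta>"
    and lyapunov: "F_weak_Lyapunov_pair \<Gamma> domf f \<T> domV V W"
begin

abbreviation "\<O> \<equiv> fst ` domV"

lemma class_V: "class_V \<Gamma> domf domV V"
  and zero_in_O: "0 \<in> \<O>"
  and W_nonneg: "\<gamma> \<in> \<Gamma> \<Longrightarrow> \<xi> \<in> O_at domf domV \<gamma> \<Longrightarrow> 0 \<le> W (\<xi>, \<gamma>)"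
  and W_le: "\<gamma> \<in> \<Gamma> \<Longrightarrow> \<xi> \<in> O_at domf domV \<gamma> \<Longrightarrow>
    W (\<xi>, \<gamma>) \<le> - inner (gradient (\<lambda>\<zeta>. V (\<zeta>, \<gamma>)) \<xi>) (f (\<xi>, \<gamma>))"
  using lyapunov unfolding F_weak_Lyapunov_pair_def by blast+

lemma V_bounds:
  obtains r\<^sub>1 r\<^sub>2 \<alpha>\<^sub>1 \<alpha>\<^sub>2 where "class_K r\<^sub>1 \<alpha>\<^sub>1" "class_K r\<^sub>2 \<alpha>\<^sub>2"
    "\<And>\<gamma> \<xi>. \<gamma> \<in> \<Gamma> \<Longrightarrow> \<xi> \<in> O_at domf domV \<gamma> \<Longrightarrow> ereal (norm \<xi>) \<le> r\<^sub>1 \<and> ereal (norm \<xi>) \<le> r\<^sub>2 \<and>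
      \<alpha>\<^sub>1 (norm \<xi>) \<le> V (\<xi>, \<gamma>) \<and> V (\<xi>, \<gamma>) \<le> \<alpha>\<^sub>2 (norm \<xi>)"
proof -
  have "\<exists>r\<^sub>1 r\<^sub>2 \<alpha>\<^sub>1 \<alpha>\<^sub>2. class_K r\<^sub>1 \<alpha>\<^sub>1 \<and> class_K r\<^sub>2 \<alpha>\<^sub>2 \<and>
      (\<forall>\<gamma>\<in>\<Gamma>. \<forall>\<xi>\<in>O_at domf domV \<gamma>. ereal (norm \<xi>) \<le> r\<^sub>1 \<and> ereal (norm \<xi>) \<le> r\<^sub>2 \<and>
        \<alpha>\<^sub>1 (norm \<xi>) \<le> V (\<xi>, \<gamma>) \<and> V (\<xi>, \<gamma>) \<le> \<alpha>\<^sub>2 (norm \<xi>))"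
    using lyapunov unfolding F_weak_Lyapunov_pair_def by (elim conjE)
  then show thesis using that by blast
qed

lemma domV_subset: "domV \<subseteq> UNIV \<times> \<Gamma>"
  and open_section: "\<gamma> \<in> \<Gamma> \<Longrightarrow> open (section_at domV \<gamma>)"
  and V_differentiable: "\<gamma> \<in> \<Gamma> \<Longrightarrow> \<xi> \<in> O_at domf domV \<gamma> \<Longrightarrow> (\<lambda>\<zeta>. V (\<zeta>, \<gamma>)) differentiable (at \<xi>)"
  using class_V unfolding class_V_def by simp_all

text \<open>Supplies the closed ball about the origin in which the local estimate is run.\<close>

lemma open_O: "open \<O>"
proof -
  have "\<O> = (\<Union>\<gamma>\<in>\<Gamma>. section_at domV \<gamma>)"
  proof (intro subset_antisym subsetI)
    fix \<xi> assume "\<xi> \<in> \<O>"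
    then obtain \<gamma> where "(\<xi>, \<gamma>) \<in> domV" by auto
    then show "\<xi> \<in> (\<Union>\<gamma>\<in>\<Gamma>. section_at domV \<gamma>)"
      using domV_subset by (auto simp: section_at_def)
  qed (auto simp: section_at_def intro: rev_image_eqI)
  then show ?thesis using open_section by auto
qed

context
  fixes I x \<sigma>
  assumes traj: "(I, x, \<sigma>) \<in> \<T>"
begin

lemma half_line: "{0..} \<subseteq> I"
  and signal: "switching_signal \<Gamma> \<sigma>"
  and solution: "ode_solution I (\<lambda>t \<xi>. f (\<xi>, \<sigma> t)) x"
  and in_domf: "t \<in> I \<Longrightarrow> (x t, \<sigma> t) \<in> domf"
  using trajectories[OF traj] unfolding trajectory_def forward_complete_def by auto

lemma mode_in: "\<sigma> t \<in> \<Gamma>"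
  using signal unfolding switching_signal_def by blast

lemma continuous_traj: "continuous_on {0..} x"
  unfolding continuous_on_eq_continuous_within
proof
  fix t :: real assume t: "t \<in> {0..}"
  have "{0..t + 1} \<subseteq> I" using half_line by auto
  then have "continuous_on {0..t + 1} x"
    using solution unfolding ode_solution_def locally_absolutely_continuous_def
    by (blast intro: absolutely_continuous_fun_imp_continuous_on)
  then have "continuous (at t within {0..t + 1}) x"
    using t by (simp add: continuous_on_eq_continuous_within)
  moreover have "at t within {0..t + 1} = at t within {0..}"
    using t by (intro at_within_nhd[of _ "{t - 1<..<t + 1}"]) auto
  ultimately show "continuous (at t within {0..}) x" by simp
qed

lemma in_O_at: "0 \<le> t \<Longrightarrow> x t \<in> \<O> \<Longrightarrow> x t \<in> O_at domf domV (\<sigma> t)"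
  using in_domf[of t] half_line by (auto simp: O_at_def section_at_def)

text \<open>\<open>\<sigma>\<close> may leave \<open>\<gamma>\<close> between \<open>s\<close> and
  \<open>t\<close>; this is why re-entering a mode costs nothing.\<close>

lemma V_decreasing:
  assumes "0 \<le> s" "s \<le> t" "\<sigma> s = \<gamma>" "\<sigma> t = \<gamma>" and "\<forall>u\<in>{s..t}. x u \<in> \<O>"
  shows "V (x t, \<gamma>) \<le> V (x s, \<gamma>)"
proof -
  have "\<forall>(I, x, \<sigma>)\<in>\<T>. \<forall>a b. 0 \<le> a \<longrightarrow> a \<le> b \<longrightarrow> (\<forall>t\<in>{a..b}. x t \<in> \<O>) \<longrightarrow>
        (\<forall>\<gamma>\<in>\<Gamma>. antimono_on ({a..b} \<inter> \<sigma> -` {\<gamma>}) (\<lambda>t. V (x t, \<gamma>)))"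
    using lyapunov unfolding F_weak_Lyapunov_pair_def by (elim conjE)
  from bspec[OF this traj] have "antimono_on ({s..t} \<inter> \<sigma> -` {\<gamma>}) (\<lambda>t. V (x t, \<gamma>))"
    using assms mode_in[of s] by simp
  then show ?thesis
    using assms by (auto dest: monotone_onD[of _ _ _ _ s t])
qed

end

text \<open>Two demands meet: norms must stay where the local comparison functions agree with their
  extensions, and the path must stay in \<open>\<O>\<close>. The strict
  \<open>\<alpha> r < \<rho>\<close> is recorded so that small trajectories are known to live in one
  compact ball inside \<open>\<O>\<close>.\<close>

lemma local_bound:
  obtains r \<rho> \<alpha> where "0 < r" "class_K_inf \<alpha>" "cball 0 \<rho> \<subseteq> \<O>" "\<alpha> r < \<rho>"
    "\<And>I x \<sigma> t\<^sub>0 t. (I, x, \<sigma>) \<in> \<T> \<Longrightarrow> 0 \<le> t\<^sub>0 \<Longrightarrow> norm (x t\<^sub>0) \<le> r \<Longrightarrow> t\<^sub>0 \<le> t \<Longrightarrow>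
      norm (x t) \<le> \<alpha> (norm (x t\<^sub>0))"
proof -
  obtain r\<^sub>1 r\<^sub>2 \<alpha>\<^sub>1 \<alpha>\<^sub>2 where K: "class_K r\<^sub>1 \<alpha>\<^sub>1" "class_K r\<^sub>2 \<alpha>\<^sub>2"
    and V: "\<And>\<gamma> \<xi>. \<gamma> \<in> \<Gamma> \<Longrightarrow> \<xi> \<in> O_at domf domV \<gamma> \<Longrightarrow> ereal (norm \<xi>) \<le> r\<^sub>1 \<and> ereal (norm \<xi>) \<le> r\<^sub>2 \<and>
      \<alpha>\<^sub>1 (norm \<xi>) \<le> V (\<xi>, \<gamma>) \<and> V (\<xi>, \<gamma>) \<le> \<alpha>\<^sub>2 (norm \<xi>)"
    by (rule V_bounds) (rule that)
  have pos: "\<exists>c>0. ereal c \<le> r" if "0 < r" for r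
    using ereal_dense2[OF that] less_imp_le by fastforce
  obtain c\<^sub>1 c\<^sub>2 where c12: "0 < c\<^sub>1" "ereal c\<^sub>1 \<le> r\<^sub>1" "0 < c\<^sub>2" "ereal c\<^sub>2 \<le> r\<^sub>2"
    using pos[of r\<^sub>1] pos[of r\<^sub>2] K unfolding class_K_def by blast
  obtain a\<^sub>1 where a1: "class_K_inf a\<^sub>1" "\<And>s. s \<le> c\<^sub>1 \<Longrightarrow> a\<^sub>1 s = \<alpha>\<^sub>1 s"
    using class_K_inf_extension[OF K(1)] c12 by metis
  obtain a\<^sub>2 where a2: "class_K_inf a\<^sub>2" "\<And>s. s \<le> c\<^sub>2 \<Longrightarrow> a\<^sub>2 s = \<alpha>\<^sub>2 s"
    using class_K_inf_extension[OF K(2)] c12 by metis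
  obtain h where h: "class_K_inf h" "\<And>s. 0 \<le> s \<Longrightarrow> s \<le> h s"
    "\<And>s u. 0 \<le> s \<Longrightarrow> 0 \<le> u \<Longrightarrow> a\<^sub>1 u \<le> a\<^sub>2 s \<Longrightarrow> u \<le> h s"
    using class_K_inf_gain[OF a1(1) a2(1)] by blast
  have "0 < a\<^sub>1 c\<^sub>1"
    using a1(1) c12 strict_mono_onD[of "{0..}" a\<^sub>1 0 c\<^sub>1] by (auto simp: class_K_inf_iff)
  then obtain c' where c': "0 < c'" "a\<^sub>2 c' < a\<^sub>1 c\<^sub>1" using class_K_inf_small[OF a2(1)] by blast
  \<comment> \<open>If \<open>norm (x s) \<le> c\<close>, then \<open>\<alpha>\<^sub>2\<close> still
    equals \<open>a\<^sub>2\<close> there (by \<open>c\<^sub>2\<close>) and \<open>V\<close> is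
    below \<open>a\<^sub>1 c\<^sub>1\<close> (by \<open>c'\<close>). This traps the later norm below
    \<open>c\<^sub>1\<close>, where \<open>\<alpha>\<^sub>1\<close> equals
    \<open>a\<^sub>1\<close>.\<close>
  define c where "c = min c' c\<^sub>2"
  have c: "0 < c" "c \<le> c\<^sub>2" "a\<^sub>2 c < a\<^sub>1 c\<^sub>1"
    using c' c12 class_K_inf_le_iff[OF a2(1), of c c'] by (auto simp: c_def min_def)
  obtain \<rho> where \<rho>: "0 < \<rho>" "cball 0 \<rho> \<subseteq> \<O>"
    using open_O zero_in_O open_contains_cball by blast
  define \<alpha> where "\<alpha> = h ^^ card \<Gamma>"
  have \<alpha>: "class_K_inf \<alpha>" unfolding \<alpha>_def by (rule class_K_inf_funpow[OF h(1)])
  obtain r where r: "0 < r" "\<alpha> r < min c \<rho>"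
    using class_K_inf_small[OF \<alpha>] c(1) \<rho>(1) by (metis min_less_iff_conj)
  have "norm (x t) \<le> \<alpha> (norm (x t\<^sub>0))"
    if tr: "(I, x, \<sigma>) \<in> \<T>" and t: "0 \<le> t\<^sub>0" "norm (x t\<^sub>0) \<le> r" "t\<^sub>0 \<le> t" for I x \<sigma> t\<^sub>0 t
    unfolding \<alpha>_def
  proof (rule norm_bound_in_ball[where \<sigma> = \<sigma> and \<rho> = \<rho> and c = c])
    show "continuous_on {t\<^sub>0..} x"
      using continuous_traj[OF tr] by (rule continuous_on_subset) (use t in auto)
    show "continuous (at_right t) \<sigma>" for t
      using signal[OF tr] unfolding switching_signal_def by blast
    show "range \<sigma> \<subseteq> \<Gamma>" using signal[OF tr] unfolding switching_signal_def by blast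
    have "\<alpha> (norm (x t\<^sub>0)) \<le> \<alpha> r"
      using class_K_inf_le_iff[OF \<alpha>, of "norm (x t\<^sub>0)" r] t r by simp
    then show "(h ^^ card \<Gamma>) (norm (x t\<^sub>0)) \<le> c" "(h ^^ card \<Gamma>) (norm (x t\<^sub>0)) < \<rho>"
      using r by (simp_all add: \<alpha>_def)
    fix s u
    assume s: "t\<^sub>0 \<le> s" "s \<le> u" "\<sigma> s = \<sigma> u" "\<forall>v\<in>{s..u}. norm (x v) \<le> \<rho>" "norm (x s) \<le> c"
    have O: "\<forall>v\<in>{s..u}. x v \<in> \<O>" using s(4) \<rho>(2) by (auto simp: subset_iff)
    have Vs: "ereal (norm (x u)) \<le> r\<^sub>1" "\<alpha>\<^sub>1 (norm (x u)) \<le> V (x u, \<sigma> u)"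
      "V (x s, \<sigma> u) \<le> \<alpha>\<^sub>2 (norm (x s))"
      using V[of "\<sigma> u" "x u"] V[of "\<sigma> u" "x s"] in_O_at[OF tr, of s] in_O_at[OF tr, of u]
        O s t mode_in[OF tr] by auto
    moreover have "V (x u, \<sigma> u) \<le> V (x s, \<sigma> u)"
      by (rule V_decreasing[OF tr]) (use s t O in auto)
    moreover have "\<alpha>\<^sub>2 (norm (x s)) = a\<^sub>2 (norm (x s))"
      using a2(2) s(5) c(2) by simp
    ultimately have le: "\<alpha>\<^sub>1 (norm (x u)) \<le> a\<^sub>2 (norm (x s))" by simp
    also have "\<dots> \<le> a\<^sub>2 c"
      using class_K_inf_le_iff[OF a2(1), of "norm (x s)" c] s(5) c(1) by simp
    also have "\<dots> < \<alpha>\<^sub>1 c\<^sub>1" using c(3) a1(2) by simp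
    finally have "norm (x u) < c\<^sub>1"
      using K(1) c12 Vs(1) strict_mono_on_less[of "{s. 0 \<le> s \<and> ereal s \<le> r\<^sub>1}" \<alpha>\<^sub>1 "norm (x u)" c\<^sub>1]
      unfolding class_K_def by auto
    then show "norm (x u) \<le> h (norm (x s))"
      using le a1(2) by (intro h(3)) auto
  qed (fact finite_modes h(1,2) t(3))+
  moreover have "\<alpha> r < \<rho>" using r by simp
  ultimately show thesis using that r(1) \<alpha> \<rho>(2) by blast
qed

lemma global_bound:
  assumes "\<O> = UNIV" and "radially_unbounded \<Gamma> domf domV V"
  obtains \<alpha> where "class_K_inf \<alpha>"
    "\<And>I x \<sigma> t\<^sub>0 t. (I, x, \<sigma>) \<in> \<T> \<Longrightarrow> 0 \<le> t\<^sub>0 \<Longrightarrow> t\<^sub>0 \<le> t \<Longrightarrow> norm (x t) \<le> \<alpha> (norm (x t\<^sub>0))"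
proof -
  obtain a\<^sub>1 a\<^sub>2 where K: "class_K_inf a\<^sub>1" "class_K_inf a\<^sub>2"
    and V: "\<And>\<gamma> \<xi>. \<gamma> \<in> \<Gamma> \<Longrightarrow> \<xi> \<in> O_at domf domV \<gamma> \<Longrightarrow>
      a\<^sub>1 (norm \<xi>) \<le> V (\<xi>, \<gamma>) \<and> V (\<xi>, \<gamma>) \<le> a\<^sub>2 (norm \<xi>)"
    using assms(2) unfolding radially_unbounded_def by blast
  obtain h where h: "class_K_inf h" "\<And>s. 0 \<le> s \<Longrightarrow> s \<le> h s"
    "\<And>s u. 0 \<le> s \<Longrightarrow> 0 \<le> u \<Longrightarrow> a\<^sub>1 u \<le> a\<^sub>2 s \<Longrightarrow> u \<le> h s"
    using class_K_inf_gain[OF K] by blast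
  have "norm (x t) \<le> (h ^^ card \<Gamma>) (norm (x t\<^sub>0))"
    if tr: "(I, x, \<sigma>) \<in> \<T>" and t: "0 \<le> t\<^sub>0" "t\<^sub>0 \<le> t" for I x \<sigma> t\<^sub>0 t
  \<comment> \<open>With \<open>\<O> = UNIV\<close> the step estimate holds everywhere, so
    \<open>\<rho>\<close> and \<open>c\<close> only have to meet their side conditions.\<close>
  proof (rule norm_bound_in_ball[where \<sigma> = \<sigma> and \<rho> = "(h ^^ card \<Gamma>) (norm (x t\<^sub>0)) + 1"
        and c = "(h ^^ card \<Gamma>) (norm (x t\<^sub>0))"])
    show "continuous_on {t\<^sub>0..} x"
      using continuous_traj[OF tr] by (rule continuous_on_subset) (use t in auto)
    show "continuous (at_right t) \<sigma>" for t
      using signal[OF tr] unfolding switching_signal_def by blast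
    show "range \<sigma> \<subseteq> \<Gamma>" using signal[OF tr] unfolding switching_signal_def by blast
    fix s u
    assume s: "t\<^sub>0 \<le> s" "s \<le> u" "\<sigma> s = \<sigma> u"
    have "V (x u, \<sigma> u) \<le> V (x s, \<sigma> u)"
      by (rule V_decreasing[OF tr]) (use s t assms(1) in auto)
    moreover have "a\<^sub>1 (norm (x u)) \<le> V (x u, \<sigma> u)" "V (x s, \<sigma> u) \<le> a\<^sub>2 (norm (x s))"
      using V[of "\<sigma> u" "x u"] V[of "\<sigma> u" "x s"] in_O_at[OF tr, of s] in_O_at[OF tr, of u]
        assms(1) s t mode_in[OF tr] by auto
    ultimately show "norm (x u) \<le> h (norm (x s))"
      by (intro h(3)) auto
  next
    show "t\<^sub>0 \<le> t" by (fact t(2))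
  qed (use finite_modes h(1,2) in simp_all)
  then show thesis using that class_K_inf_funpow[OF h(1)] by blast
qed

end

section \<open>Limits of integral curves\<close>

text \<open>If no jump occurs within \<open>\<tau> / 2\<close> after \<open>t\<close>, the window
  lies to the right of \<open>t\<close>. Otherwise take such a jump \<open>s\<close>: the open
  stretch of length \<open>\<tau>\<close> before \<open>s\<close> is free of jumps and contains the
  \<open>\<tau> / 4\<close> preceding \<open>t\<close>.\<close>

lemma dwell_window:
  assumes sw: "switching_signal \<Gamma> \<sigma>" and \<tau>: "0 < \<tau>"
    and dwell: "\<forall>t\<in>jumps \<sigma>. \<forall>t'\<in>jumps \<sigma>. t \<noteq> t' \<longrightarrow> \<tau> \<le> \<bar>t - t'\<bar>"
  obtains a where "a \<le> t" "t \<le> a + \<tau> / 4" "\<And>u. u \<in> {a..a + \<tau> / 4} \<Longrightarrow> \<sigma> u = \<sigma> t"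
proof (cases "{t<..<t + \<tau> / 2} \<inter> jumps \<sigma> = {}")
  case True
  then obtain c where c: "\<And>u. u \<in> {t<..<t + \<tau> / 2} \<Longrightarrow> \<sigma> u = c"
    using sw unfolding switching_signal_def constant_on_def by metis
  \<comment> \<open>Constancy is known on the open interval only; right continuity adds the point
    \<open>t\<close>.\<close>
  have "eventually (\<lambda>u. \<sigma> u = c) (at_right t)"
    using c \<tau> by (intro eventually_at_rightI[of t "t + \<tau> / 2"]) auto
  then have "(\<sigma> \<longlongrightarrow> c) (at_right t)" by (rule tendsto_eventually)
  moreover have "(\<sigma> \<longlongrightarrow> \<sigma> t) (at_right t)"
    using sw unfolding switching_signal_def by (simp add: continuous_within)
  ultimately have "\<sigma> t = c" by (metis tendsto_unique trivial_limit_at_right_real)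
  then have "\<sigma> u = \<sigma> t" if "u \<in> {t..t + \<tau> / 4}" for u
    using c[of u] that \<tau> by (cases "u = t") auto
  moreover have "t \<le> t" "t \<le> t + \<tau> / 4" using \<tau> by simp_all
  ultimately show thesis using that by blast
next
  case False
  then obtain s where s: "t < s" "s < t + \<tau> / 2" "s \<in> jumps \<sigma>" by auto
  have "{s - \<tau><..<s} \<inter> jumps \<sigma> = {}"
  proof (intro subset_antisym subsetI)
    fix u assume "u \<in> {s - \<tau><..<s} \<inter> jumps \<sigma>"
    then show "u \<in> {}" using dwell s by fastforce
  qed simp
  then obtain c where c: "\<And>u. u \<in> {s - \<tau><..<s} \<Longrightarrow> \<sigma> u = c"
    using sw unfolding switching_signal_def constant_on_def by metis
  have "\<sigma> u = \<sigma> t" if "u \<in> {t - \<tau> / 4..t - \<tau> / 4 + \<tau> / 4}" for u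
    using c[of u] c[of t] that s by simp
  moreover have "t - \<tau> / 4 \<le> t" "t \<le> t - \<tau> / 4 + \<tau> / 4" using \<tau> by simp_all
  ultimately show thesis using that by blast
qed

text \<open>The hypothesis on \<open>X n\<close> is the mean value inequality that \<open>X n\<close> satisfies as an integral curve of \<open>g\<close>;
  in this form it passes to the limit without integrals.\<close>

lemma limit_of_integral_curves:
  fixes X :: "nat \<Rightarrow> real \<Rightarrow> 'a::real_normed_vector"
  assumes mvi: "\<And>n u v c M. 0 \<le> u \<Longrightarrow> u \<le> v \<Longrightarrow> v \<le> L \<Longrightarrow> 0 \<le> M \<Longrightarrow>
      (\<And>w. w \<in> {u..v} \<Longrightarrow> norm (g (X n w) - c) \<le> M) \<Longrightarrow> norm (X n v - X n u - (v - u) *\<^sub>R c) \<le> M * (v - u)"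
    and C: "closed C" "\<And>n u. u \<in> {0..L} \<Longrightarrow> X n u \<in> C" and g: "continuous_on C g"
    and y: "continuous_on {0..L} y"
    and unif: "\<And>e. 0 < e \<Longrightarrow> \<exists>N. \<forall>n u. n \<ge> N \<and> u \<in> {0..L} \<longrightarrow> norm (X n u - y u) < e"
    and t: "t \<in> {0..L}"
  shows "y t \<in> C" and "(y has_vector_derivative g (y t)) (at t within {0..L})"
proof -
  have lim: "(\<lambda>n. X n u) \<longlonglongrightarrow> y u" if "u \<in> {0..L}" for u
    using unif that unfolding lim_sequentially dist_norm by meson
  show yC: "y t \<in> C" using closed_sequentially[OF C(1) _ lim[OF t]] C(2) t by simp
  show "(y has_vector_derivative g (y t)) (at t within {0..L})"
    unfolding has_vector_derivative_def has_derivative_within_alt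
  proof (intro conjI allI impI)
    show "bounded_linear (\<lambda>h. h *\<^sub>R g (y t))" by (rule bounded_linear_scaleR_left)
    fix e :: real assume e: "0 < e"
    obtain d where d: "0 < d" "\<And>z. z \<in> C \<Longrightarrow> dist z (y t) < d \<Longrightarrow> dist (g z) (g (y t)) < e"
      using g yC e unfolding continuous_on_iff by metis
    obtain r where r: "0 < r" "\<And>u. u \<in> {0..L} \<Longrightarrow> dist u t < r \<Longrightarrow> dist (y u) (y t) < d / 2"
      using y t d(1) unfolding continuous_on_iff by (metis half_gt_zero)
    obtain N where N: "\<And>n u. n \<ge> N \<Longrightarrow> u \<in> {0..L} \<Longrightarrow> norm (X n u - y u) < d / 2"
      using unif[of "d / 2"] d(1) by auto
    have near: "norm (g (X n w) - g (y t)) \<le> e" if "n \<ge> N" "w \<in> {0..L}" "dist w t < r" for n w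
    proof -
      have "dist (X n w) (y t) < d"
        using N[OF that(1,2)] r(2)[OF that(2,3)] dist_triangle[of "X n w" "y t" "y w"]
        by (simp add: dist_norm)
      then show ?thesis using d(2)[of "X n w"] C(2) that by (simp add: dist_norm)
    qed
    \<comment> \<open>Taking \<open>u = t\<close> or \<open>v = t\<close> gives the right and the
      left difference quotient.\<close>
    have seg: "norm (y v - y u - (v - u) *\<^sub>R g (y t)) \<le> e * (v - u)"
      if uv: "0 \<le> u" "u \<le> v" "v \<le> L" "dist u t < r" "dist v t < r" for u v
    proof (rule tendsto_upperbound)
      show "(\<lambda>n. norm (X n v - X n u - (v - u) *\<^sub>R g (y t))) \<longlonglongrightarrow> norm (y v - y u - (v - u) *\<^sub>R g (y t))"
        using uv by (intro tendsto_intros lim) auto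
      show "\<forall>\<^sub>F n in sequentially. norm (X n v - X n u - (v - u) *\<^sub>R g (y t)) \<le> e * (v - u)"
        using eventually_ge_at_top[of N]
      proof eventually_elim
        case (elim n)
        show ?case
          by (rule mvi) (use uv e near[OF elim] in \<open>auto simp: dist_real_def\<close>)
      qed
    qed simp
    have "norm (y u - y t - (u - t) *\<^sub>R g (y t)) \<le> e * norm (u - t)"
      if u: "u \<in> {0..L}" "norm (u - t) < r" for u
    proof (cases "t \<le> u")
      case True
      then show ?thesis using seg[of t u] u t r(1) by (simp add: dist_real_def)
    next
      case False
      have "norm (y u - y t - (u - t) *\<^sub>R g (y t)) = norm (y t - y u - (t - u) *\<^sub>R g (y t))"
        by (subst norm_minus_commute[symmetric]) (simp add: algebra_simps)
      then show ?thesis using seg[of u t] u t r(1) False by (simp add: dist_real_def)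
    qed
    then show "\<exists>r>0. \<forall>u\<in>{0..L}. norm (u - t) < r \<longrightarrow>
        norm (y u - y t - (u - t) *\<^sub>R g (y t)) \<le> e * norm (u - t)"
      using r(1) by blast
  qed
qed

section \<open>Classical solutions, gradients and level curves\<close>

lemma lipschitz_imp_absolutely_continuous_fun:
  fixes x :: "real \<Rightarrow> 'a::real_normed_vector"
  assumes lip: "\<And>u v. u \<in> S \<Longrightarrow> v \<in> S \<Longrightarrow> u \<le> v \<Longrightarrow> norm (x v - x u) \<le> M * (v - u)" and M: "0 \<le> M"
  shows "absolutely_continuous_fun S x"
  unfolding absolutely_continuous_fun_def
proof (intro allI impI)
  fix e :: real assume e: "0 < e"
  show "\<exists>\<delta>>0. \<forall>(k::nat) a b.
        (\<forall>i<k. a i \<le> b i \<and> {a i..b i} \<subseteq> S) \<longrightarrow>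
        (\<forall>i<k. \<forall>j<k. i \<noteq> j \<longrightarrow> {a i<..<b i} \<inter> {a j<..<b j} = {}) \<longrightarrow>
        (\<Sum>i<k. b i - a i) < \<delta> \<longrightarrow> (\<Sum>i<k. norm (x (b i) - x (a i))) < e"
  proof (intro exI[of _ "e / (M + 1)"] conjI allI impI)
    show "0 < e / (M + 1)" using e M by simp
    fix k :: nat and a b :: "nat \<Rightarrow> real"
    assume ab: "\<forall>i<k. a i \<le> b i \<and> {a i..b i} \<subseteq> S" and len: "(\<Sum>i<k. b i - a i) < e / (M + 1)"
    have "(\<Sum>i<k. norm (x (b i) - x (a i))) \<le> (\<Sum>i<k. M * (b i - a i))"
      using ab by (intro sum_mono lip) (auto simp: subset_iff)
    also have "\<dots> \<le> (M + 1) * (\<Sum>i<k. b i - a i)"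
      unfolding sum_distrib_left using ab by (intro sum_mono mult_right_mono) auto
    also have "\<dots> < e" using len M by (simp add: field_simps)
    finally show "(\<Sum>i<k. norm (x (b i) - x (a i))) < e" .
  qed
qed

lemma differentiable_imp_ode_solution:
  fixes y :: "real \<Rightarrow> 'a::real_normed_vector"
  assumes ab: "a \<le> b"
    and deriv: "\<And>t. t \<in> {a..b} \<Longrightarrow> (y has_vector_derivative g (y t)) (at t within {a..b})"
    and lip: "\<And>u v. u \<in> {a..b} \<Longrightarrow> v \<in> {a..b} \<Longrightarrow> u \<le> v \<Longrightarrow> norm (y v - y u) \<le> M * (v - u)" and M: "0 \<le> M"
  shows "ode_solution {a..b} (\<lambda>t. g) y"
  unfolding ode_solution_def locally_absolutely_continuous_def
proof (intro conjI allI impI)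
  show "is_interval {a..b}" by (rule is_interval_cc)
  show "{a..b} \<noteq> {}" using ab by simp
  show "absolutely_continuous_fun {c..d} y" if "{c..d} \<subseteq> {a..b}" for c d
    using lip M that by (intro lipschitz_imp_absolutely_continuous_fun[where M = M]) blast+
  show "AE t in lebesgue. t \<in> {a..b} \<longrightarrow> (y has_vector_derivative g (y t)) (at t within {a..b})"
    using deriv by (intro AE_I2) blast
qed

text \<open>The derivative is the inner product with its adjoint applied to 1 (Riesz
  representation); uniqueness of derivatives makes the \<open>THE\<close> in \<open>gradient\<close>
  well defined.\<close>

lemma gderiv_gradient:
  fixes U :: "'a::euclidean_space \<Rightarrow> real"
  assumes "U differentiable (at \<xi>)"
  shows "GDERIV U \<xi> :> gradient U \<xi>"
proof -
  obtain F where F: "(U has_derivative F) (at \<xi>)" using assms unfolding differentiable_def by blast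
  then have "linear F" using has_derivative_linear by blast
  then have "F = (\<lambda>h. inner h (adjoint F 1))"
    using adjoint_works[of F _ 1] by auto
  then have G: "GDERIV U \<xi> :> adjoint F 1" using F unfolding gderiv_def by simp
  have "D = D'" if "GDERIV U \<xi> :> D" "GDERIV U \<xi> :> D'" for D D'
  proof -
    have "(\<lambda>h. inner h D) = (\<lambda>h. inner h D')"
      using that has_derivative_unique unfolding gderiv_def by blast
    then show ?thesis by (metis vector_eq_ldot)
  qed
  then show ?thesis unfolding gradient_def using G by (metis (mono_tags, lifting) theI)
qed

text \<open>The chain rule at a single point, so that plain differentiability of \<open>U\<close>
  there suffices. With \<open>D\<close> the value of the vector field it makes the upper bound on
  \<open>W\<close> vanish.\<close>

lemma gradient_orthogonal_to_level_curve:
  fixes U :: "'a::euclidean_space \<Rightarrow> real"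
  assumes diff: "U differentiable (at (y t))" and y: "(y has_vector_derivative D) (at t)"
    and level: "open J" "t \<in> J" "\<And>u. u \<in> J \<Longrightarrow> U (y u) = c"
  shows "inner (gradient U (y t)) D = 0"
proof -
  have "((U \<circ> y) has_derivative (\<lambda>h. inner h (gradient U (y t))) \<circ> (\<lambda>h. h *\<^sub>R D)) (at t)"
    using gderiv_gradient[OF diff] y
    unfolding gderiv_def has_vector_derivative_def by (intro diff_chain_at)
  moreover have "((U \<circ> y) has_derivative (\<lambda>h. 0)) (at t)"
    by (rule has_derivative_transform_within_open[of "\<lambda>_. c" _ _ _ J]) (use level in auto)
  ultimately have "(\<lambda>h. inner h (gradient U (y t))) \<circ> (\<lambda>h. h *\<^sub>R D) = (\<lambda>h. 0)"
    by (rule has_derivative_unique)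
  from fun_cong[OF this, of 1] show ?thesis by (simp add: inner_commute)
qed

section \<open>Attractivity\<close>

context weak_lyapunov_family
begin

text \<open>Finiteness of \<open>\<Gamma>\<close> makes
  \<open>(K \<times> \<Gamma>) \<inter> domf\<close> compact. The bound becomes the common Lipschitz
  constant behind equicontinuity.\<close>

lemma speed_bound:
  assumes "compact K"
  obtains M where "0 \<le> M" "\<And>\<xi> \<gamma>. \<xi> \<in> K \<Longrightarrow> \<gamma> \<in> \<Gamma> \<Longrightarrow> (\<xi>, \<gamma>) \<in> domf \<Longrightarrow> norm (f (\<xi>, \<gamma>)) \<le> M"
proof -
  have "compact ((K \<times> \<Gamma>) \<inter> domf)"
    by (intro compact_Int_closed compact_Times assms finite_imp_compact[OF finite_modes] closed_domf)
  then have "compact (f ` ((K \<times> \<Gamma>) \<inter> domf))"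
    using continuous_f by (intro compact_continuous_image) (auto intro: continuous_on_subset)
  then obtain M where M: "\<And>z. z \<in> f ` ((K \<times> \<Gamma>) \<inter> domf) \<Longrightarrow> norm z \<le> M"
    using compact_imp_bounded bounded_iff by metis
  show thesis
  proof (rule that[of "\<bar>M\<bar>"])
    fix \<xi> \<gamma> assume "\<xi> \<in> K" "\<gamma> \<in> \<Gamma>" "(\<xi>, \<gamma>) \<in> domf"
    then have "norm (f (\<xi>, \<gamma>)) \<le> M" by (intro M) auto
    then show "norm (f (\<xi>, \<gamma>)) \<le> \<bar>M\<bar>" by simp
  qed simp
qed

lemma closed_section: "closed (section_at domf \<gamma>)"
proof -
  have "closed ((\<lambda>\<xi>. (\<xi>, \<gamma>)) -` domf)"
    by (rule closed_vimage[OF closed_domf]) (intro continuous_intros)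
  then show ?thesis by (simp add: section_at_def vimage_def)
qed

lemma continuous_on_section: "continuous_on (section_at domf \<gamma>) (\<lambda>\<xi>. f (\<xi>, \<gamma>))"
  by (rule continuous_on_compose2[OF continuous_f]) (auto intro!: continuous_intros simp: section_at_def)

text \<open>The bound is asked for at every time, while the differential equation holds only almost
  everywhere; jumps of \<open>\<sigma>\<close> inside \<open>{a..b}\<close> do no harm.\<close>

lemma traj_mean_value:
  assumes traj: "(I, x, \<sigma>) \<in> \<T>" and "0 \<le> a" "a \<le> b" "0 \<le> M"
    and f: "\<And>w. w \<in> {a..b} \<Longrightarrow> norm (f (x w, \<sigma> w) - c) \<le> M"
  shows "norm (x b - x a - (b - a) *\<^sub>R c) \<le> M * (b - a)"
proof (rule absolutely_continuous_mean_value)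
  have sub: "{a..b} \<subseteq> I" using half_line[OF traj] assms by auto
  then show "absolutely_continuous_fun {a..b} x"
    using solution[OF traj] unfolding ode_solution_def locally_absolutely_continuous_def by blast
  have "AE t in lebesgue. t \<in> I \<longrightarrow> (x has_vector_derivative f (x t, \<sigma> t)) (at t within I)"
    using solution[OF traj] unfolding ode_solution_def by blast
  then show "AE t in lebesgue. t \<in> {a..b} \<longrightarrow>
      (\<exists>D. (x has_vector_derivative D) (at t within {a..b}) \<and> norm (D - c) \<le> M)"
  proof eventually_elim
    case (elim t)
    then show ?case using sub f has_vector_derivative_within_subset by blast
  qed
qed (use assms in auto)

lemma V_nonneg:
  assumes "\<gamma> \<in> \<Gamma>" "\<xi> \<in> O_at domf domV \<gamma>"
  shows "0 \<le> V (\<xi>, \<gamma>)"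
proof -
  obtain r\<^sub>1 \<alpha>\<^sub>1 where K: "class_K r\<^sub>1 \<alpha>\<^sub>1"
    and V: "ereal (norm \<xi>) \<le> r\<^sub>1" "\<alpha>\<^sub>1 (norm \<xi>) \<le> V (\<xi>, \<gamma>)"
    by (rule V_bounds) (use assms in blast)
  have z: "\<alpha>\<^sub>1 0 = 0" and mono: "strict_mono_on {s. 0 \<le> s \<and> ereal s \<le> r\<^sub>1} \<alpha>\<^sub>1" and r: "0 < r\<^sub>1"
    using K unfolding class_K_def by simp_all
  have "\<alpha>\<^sub>1 0 \<le> \<alpha>\<^sub>1 (norm \<xi>)"
    by (rule strict_mono_on_leD[OF mono]) (use V(1) r in \<open>simp_all add: zero_ereal_def[symmetric] less_imp_le\<close>)
  then show ?thesis using V(2) z by simp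
qed

context
  fixes I x \<sigma> K
  assumes traj: "(I, x, \<sigma>) \<in> \<T>"
    and K: "compact K" "K \<subseteq> \<O>" and in_K: "\<And>t. 0 \<le> t \<Longrightarrow> x t \<in> K"
begin

text \<open>Along the times of one mode \<open>V\<close> is nonincreasing and nonnegative, so it
  tends to its infimum. What matters is that one \<open>c\<close> serves all sequences
  \<open>s\<close>: points at different offsets of a limit curve then get the same value of
  \<open>V\<close>.\<close>

lemma V_tendsto_along_mode:
  obtains c where "\<And>s. filterlim s at_top sequentially \<Longrightarrow> (\<And>n. \<sigma> (s n) = \<gamma>) \<Longrightarrow>
    (\<lambda>n::nat. V (x (s n), \<gamma>)) \<longlonglongrightarrow> c"
proof
  define A where "A = {t. 0 \<le> t \<and> \<sigma> t = \<gamma>}"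
  define v where "v t = V (x t, \<gamma>)" for t
  fix s :: "nat \<Rightarrow> real"
  assume s: "filterlim s at_top sequentially" and mode: "\<And>n. \<sigma> (s n) = \<gamma>"
  have O: "x t \<in> \<O>" if "0 \<le> t" for t using in_K[OF that] K(2) by blast
  have "0 \<le> v t" if "t \<in> A" for t
    using V_nonneg[OF mode_in[OF traj] in_O_at[OF traj _ O]] that by (auto simp: A_def v_def)
  then have bdd: "bdd_below (v ` A)" by (intro bdd_belowI) auto
  have dec: "v u \<le> v t" if "t \<in> A" "t \<le> u" "\<sigma> u = \<gamma>" for t u
    unfolding v_def by (rule V_decreasing[OF traj]) (use that O in \<open>auto simp: A_def\<close>)
  have large: "eventually (\<lambda>n. t \<le> s n) sequentially" for t
    using s by (simp add: filterlim_at_top)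
  have sA: "s n \<in> A" if "0 \<le> s n" for n using that mode by (simp add: A_def)
  have "(\<lambda>n. v (s n)) \<longlonglongrightarrow> Inf (v ` A)"
  proof (rule order_tendstoI)
    fix b assume b: "b < Inf (v ` A)"
    show "eventually (\<lambda>n. b < v (s n)) sequentially"
      using large[of 0]
    proof eventually_elim
      case (elim n)
      have "Inf (v ` A) \<le> v (s n)" using sA[OF elim] bdd by (intro cInf_lower) auto
      then show ?case using b by simp
    qed
  next
    fix b assume b: "Inf (v ` A) < b"
    have "A \<noteq> {}" using eventually_happens[OF large[of 0]] sA by auto
    then obtain t where t: "t \<in> A" "v t < b" using b cInf_lessD[of "v ` A" b] by auto
    show "eventually (\<lambda>n. v (s n) < b) sequentially"
      using large[of t]
    proof eventually_elim
      case (elim n)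
      show ?case using dec[OF t(1) elim mode] t(2) by simp
    qed
  qed
  then show "(\<lambda>n. V (x (s n), \<gamma>)) \<longlonglongrightarrow> Inf ((\<lambda>t. V (x t, \<gamma>)) ` {t. 0 \<le> t \<and> \<sigma> t = \<gamma>})"
    by (simp add: v_def A_def)
qed

end

end

section \<open>Unobservable curves and the speed along one mode\<close>

lemma ode_solution_shift:
  fixes y :: "real \<Rightarrow> 'a::real_normed_vector"
  assumes ab: "a \<le> b" "l \<le> t + a" "t + b \<le> r"
    and deriv: "\<And>t. t \<in> {l..r} \<Longrightarrow> (y has_vector_derivative g (y t)) (at t within {l..r})"
    and lip: "\<And>u v. u \<in> {l..r} \<Longrightarrow> v \<in> {l..r} \<Longrightarrow> u \<le> v \<Longrightarrow> norm (y v - y u) \<le> M * (v - u)" and M: "0 \<le> M"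
  shows "ode_solution {a..b} (\<lambda>t. g) (\<lambda>u. y (t + u))"
proof (rule differentiable_imp_ode_solution[OF ab(1) _ _ M])
  fix u assume u: "u \<in> {a..b}"
  have "((\<lambda>u. t + u) has_vector_derivative 1) (at u within {a..b})"
    by (auto intro!: derivative_eq_intros)
  moreover have "(y has_vector_derivative g (y (t + u))) (at (t + u) within (\<lambda>u. t + u) ` {a..b})"
    by (rule has_vector_derivative_within_subset[OF deriv]) (use u ab in auto)
  ultimately have "((y \<circ> (\<lambda>u. t + u)) has_vector_derivative 1 *\<^sub>R g (y (t + u))) (at u within {a..b})"
    by (rule vector_diff_chain_within)
  then show "((\<lambda>u. y (t + u)) has_vector_derivative g (y (t + u))) (at u within {a..b})"
    by (simp add: o_def)
next
  fix u v assume "u \<in> {a..b}" "v \<in> {a..b}" "u \<le> v"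
  then show "norm (y (t + v) - y (t + u)) \<le> M * (v - u)"
    using lip[of "t + u" "t + v"] ab by simp
qed

context weak_lyapunov_family
begin

text \<open>An interior time has room on both sides, so the curve, translated to pass through
  \<open>y t\<close> at time 0, witnesses whichever of the two observability sets is known.\<close>

lemma equilibrium_of_unobservable_curve:
  assumes obs: "obs_bwd (O_at domf domV \<gamma>) (\<lambda>\<xi>. f (\<xi>, \<gamma>)) (\<lambda>\<xi>. W (\<xi>, \<gamma>))
        = equilibria domf f \<gamma> \<inter> O_at domf domV \<gamma> \<or>
      obs_fwd (O_at domf domV \<gamma>) (\<lambda>\<xi>. f (\<xi>, \<gamma>)) (\<lambda>\<xi>. W (\<xi>, \<gamma>))
        = equilibria domf f \<gamma> \<inter> O_at domf domV \<gamma>"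
    and y: "\<And>u. u \<in> {0..L} \<Longrightarrow> y u \<in> O_at domf domV \<gamma>"
    and deriv: "\<And>u. u \<in> {0..L} \<Longrightarrow> (y has_vector_derivative f (y u, \<gamma>)) (at u within {0..L})"
    and lip: "\<And>u v. u \<in> {0..L} \<Longrightarrow> v \<in> {0..L} \<Longrightarrow> u \<le> v \<Longrightarrow> norm (y v - y u) \<le> M * (v - u)" and M: "0 \<le> M"
    and W: "\<And>u. u \<in> {0<..<L} \<Longrightarrow> W (y u, \<gamma>) = 0"
    and t: "t \<in> {0<..<L}"
  shows "f (y t, \<gamma>) = 0"
  using obs
proof
  assume eq: "obs_bwd (O_at domf domV \<gamma>) (\<lambda>\<xi>. f (\<xi>, \<gamma>)) (\<lambda>\<xi>. W (\<xi>, \<gamma>))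
        = equilibria domf f \<gamma> \<inter> O_at domf domV \<gamma>"
  \<comment> \<open>Half of the available time keeps the piece inside the open interval, the only
    place where \<open>W\<close> is known to vanish.\<close>
  have "ode_solution {- (t / 2)..0} (\<lambda>t \<xi>. f (\<xi>, \<gamma>)) (\<lambda>u. y (t + u))"
    by (rule ode_solution_shift[OF _ _ _ deriv lip M]) (use t in auto)
  then have "y t \<in> obs_bwd_on (O_at domf domV \<gamma>) (\<lambda>\<xi>. f (\<xi>, \<gamma>)) (\<lambda>\<xi>. W (\<xi>, \<gamma>)) (t / 2)"
    using t y W unfolding obs_bwd_on_def by (intro CollectI conjI exI[of _ "\<lambda>u. y (t + u)"]) auto
  then show ?thesis using t eq unfolding obs_bwd_def equilibria_def by auto
next
  assume eq: "obs_fwd (O_at domf domV \<gamma>) (\<lambda>\<xi>. f (\<xi>, \<gamma>)) (\<lambda>\<xi>. W (\<xi>, \<gamma>))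
        = equilibria domf f \<gamma> \<inter> O_at domf domV \<gamma>"
  have "ode_solution {0..(L - t) / 2} (\<lambda>t \<xi>. f (\<xi>, \<gamma>)) (\<lambda>u. y (t + u))"
    by (rule ode_solution_shift[OF _ _ _ deriv lip M]) (use t in \<open>auto simp: field_simps\<close>)
  then have "y t \<in> obs_fwd_on (O_at domf domV \<gamma>) (\<lambda>\<xi>. f (\<xi>, \<gamma>)) (\<lambda>\<xi>. W (\<xi>, \<gamma>)) ((L - t) / 2)"
    using t y W unfolding obs_fwd_on_def
    by (intro CollectI conjI exI[of _ "\<lambda>u. y (t + u)"]) (auto simp: field_simps)
  moreover have "0 < (L - t) / 2" using t by simp
  ultimately show ?thesis using eq unfolding obs_fwd_def equilibria_def by blast
qed

context
  fixes I x \<sigma> K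
  assumes traj: "(I, x, \<sigma>) \<in> \<T>"
    and K: "compact K" "K \<subseteq> \<O>" and in_K: "\<And>t. 0 \<le> t \<Longrightarrow> x t \<in> K"
begin

text \<open>The limit curve turns out to be constant, so uniform convergence can be evaluated at
  arbitrary times \<open>t n\<close> of the windows and not just at a fixed offset. A subsequence is
  enough to refute a speed bounded away from zero.\<close>

lemma speed_tendsto_along_mode:
  fixes a t :: "nat \<Rightarrow> real"
  assumes \<gamma>: "\<gamma> \<in> \<Gamma>"
    and obs: "obs_bwd (O_at domf domV \<gamma>) (\<lambda>\<xi>. f (\<xi>, \<gamma>)) (\<lambda>\<xi>. W (\<xi>, \<gamma>))
        = equilibria domf f \<gamma> \<inter> O_at domf domV \<gamma> \<or>
      obs_fwd (O_at domf domV \<gamma>) (\<lambda>\<xi>. f (\<xi>, \<gamma>)) (\<lambda>\<xi>. W (\<xi>, \<gamma>))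
        = equilibria domf f \<gamma> \<inter> O_at domf domV \<gamma>"
    and L: "0 < L" and a0: "\<And>n. 0 \<le> a n" and a: "filterlim a at_top sequentially"
    and mode: "\<And>n u. u \<in> {a n..a n + L} \<Longrightarrow> \<sigma> u = \<gamma>"
    and t: "\<And>n. t n \<in> {a n..a n + L}"
  obtains k where "strict_mono k" "(\<lambda>n. f (x (t (k n)), \<gamma>)) \<longlonglongrightarrow> 0"
proof -
  define X where "X n u = x (a n + u)" for n u
  \<comment> \<open>Closed and contained in \<open>\<O>\<close>, this set keeps the limit curve in
    \<open>O_at domf domV \<gamma>\<close>.\<close>
  define C where "C = section_at domf \<gamma> \<inter> K"
  define g where "g \<xi> = f (\<xi>, \<gamma>)" for \<xi>
  obtain M where M: "0 \<le> M" "\<And>\<xi> \<gamma>. \<xi> \<in> K \<Longrightarrow> \<gamma> \<in> \<Gamma> \<Longrightarrow> (\<xi>, \<gamma>) \<in> domf \<Longrightarrow> norm (f (\<xi>, \<gamma>)) \<le> M"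
    using speed_bound[OF K(1)] by blast
  have C: "closed C" unfolding C_def
    by (intro closed_Int closed_section compact_imp_closed K)
  have CO: "C \<subseteq> O_at domf domV \<gamma>" using K(2) by (auto simp: C_def O_at_def)
  have cont_g: "continuous_on C g"
    unfolding g_def C_def by (rule continuous_on_subset[OF continuous_on_section]) auto
  have gM: "norm (g z) \<le> M" if "z \<in> C" for z
    using M(2)[of z \<gamma>] that \<gamma> by (auto simp: g_def C_def section_at_def)
  have modeX: "\<sigma> (a n + u) = \<gamma>" if "u \<in> {0..L}" for n u
    using that by (intro mode[of _ n]) auto
  have XC: "X n u \<in> C" if u: "u \<in> {0..L}" for n u
  proof -
    have nn: "0 \<le> a n + u" using a0[of n] u by simp
    then have "(x (a n + u), \<gamma>) \<in> domf"
      using in_domf[OF traj, of "a n + u"] half_line[OF traj] modeX[OF u, of n] by auto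
    then show ?thesis using in_K[OF nn] by (simp add: C_def section_at_def X_def)
  qed
  have mvi: "norm (X n v - X n u - (v - u) *\<^sub>R c) \<le> B * (v - u)"
    if uv: "0 \<le> u" "u \<le> v" "v \<le> L" "0 \<le> B" and B: "\<And>w. w \<in> {u..v} \<Longrightarrow> norm (g (X n w) - c) \<le> B" for n u v c B
  proof -
    have "norm (x (a n + v) - x (a n + u) - ((a n + v) - (a n + u)) *\<^sub>R c) \<le> B * ((a n + v) - (a n + u))"
    proof (rule traj_mean_value[OF traj])
      fix w assume w: "w \<in> {a n + u..a n + v}"
      have "norm (g (X n (w - a n)) - c) \<le> B" using w by (intro B) auto
      moreover have "\<sigma> w = \<gamma>" using w uv by (intro mode[of _ n]) auto
      ultimately show "norm (f (x w, \<sigma> w) - c) \<le> B" by (simp add: X_def g_def)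
    qed (use a0[of n] uv in auto)
    then show ?thesis by (simp add: X_def)
  qed
  \<comment> \<open>The choice \<open>c = 0\<close> in \<open>mvi\<close> gives a Lipschitz constant
    independent of \<open>n\<close>.\<close>
  have lipX: "norm (X n v - X n u) \<le> M * (v - u)" if "u \<in> {0..L}" "v \<in> {0..L}" "u \<le> v" for n u v
    using mvi[of u v M n 0] gM XC that M(1) by auto
  obtain B where B: "\<And>z. z \<in> K \<Longrightarrow> norm z \<le> B"
    using compact_imp_bounded[OF K(1)] bounded_iff by metis
  have equicont: "\<exists>d>0. \<forall>n v. v \<in> {0..L} \<and> norm (u - v) < d \<longrightarrow> norm (X n u - X n v) < e"
    if u: "u \<in> {0..L}" and e: "0 < e" for u e
  proof (intro exI[of _ "e / (M + 1)"] conjI allI impI)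
    show "0 < e / (M + 1)" using e M by simp
    fix n v assume v: "v \<in> {0..L} \<and> norm (u - v) < e / (M + 1)"
    have "norm (X n u - X n v) \<le> M * \<bar>u - v\<bar>"
      using lipX[of u v n] lipX[of v u n] u v by (cases "u \<le> v") (auto simp: norm_minus_commute)
    also have "\<dots> \<le> (M + 1) * \<bar>u - v\<bar>" by (intro mult_right_mono) auto
    also have "\<dots> < e" using v M(1) by (simp add: field_simps)
    finally show "norm (X n u - X n v) < e" .
  qed
  obtain y k where y: "continuous_on {0..L} y" and k: "strict_mono (k :: nat \<Rightarrow> nat)"
    and unif: "\<And>e. 0 < e \<Longrightarrow> \<exists>N. \<forall>n u. n \<ge> N \<and> u \<in> {0..L} \<longrightarrow> norm (X (k n) u - y u) < e"
  proof (rule Arzela_Ascoli[of "{0..L}" X B])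
    show "norm (X n u) \<le> B" if "u \<in> {0..L}" for n u
      using B XC[OF that, of n] by (simp add: C_def)
  qed (use equicont in auto)
  have lim: "(\<lambda>n. X (k n) u) \<longlonglongrightarrow> y u" if "u \<in> {0..L}" for u
    using unif that unfolding lim_sequentially dist_norm by meson
  note limit = limit_of_integral_curves[where X = "\<lambda>n. X (k n)", OF mvi C XC cont_g y unif]
  have yC: "y u \<in> C" and deriv: "(y has_vector_derivative g (y u)) (at u within {0..L})"
    if "u \<in> {0..L}" for u
    using limit that by blast+
  have lipy: "norm (y v - y u) \<le> M * (v - u)" if "u \<in> {0..L}" "v \<in> {0..L}" "u \<le> v" for u v
    by (rule tendsto_upperbound[OF tendsto_norm[OF tendsto_diff[OF lim lim]]]) (use lipX that in auto)
  obtain c where c: "\<And>s. filterlim s at_top sequentially \<Longrightarrow> (\<And>n. \<sigma> (s n) = \<gamma>) \<Longrightarrow>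
      (\<lambda>n::nat. V (x (s n), \<gamma>)) \<longlonglongrightarrow> c"
    using V_tendsto_along_mode[OF traj K in_K] by blast
  \<comment> \<open>The times \<open>a (k n) + u\<close> run to infinity in mode
    \<open>\<gamma>\<close> for each offset \<open>u\<close>, always with the same limit
    \<open>c\<close>; differentiability makes \<open>V\<close> continuous at
    \<open>y u\<close>.\<close>
  have level: "V (y u, \<gamma>) = c" if u: "u \<in> {0..L}" for u
  proof -
    have "filterlim (\<lambda>n. a (k n)) at_top sequentially"
      using filterlim_compose[OF a filterlim_subseq[OF k]] .
    then have "filterlim (\<lambda>n. a (k n) + u) at_top sequentially"
      by (rule filterlim_at_top_mono) (use u in auto)
    from c[OF this] have "(\<lambda>n. V (X (k n) u, \<gamma>)) \<longlonglongrightarrow> c"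
      using modeX[OF u] by (simp add: X_def)
    moreover have "isCont (\<lambda>\<xi>. V (\<xi>, \<gamma>)) (y u)"
      using V_differentiable[OF \<gamma>] yC[OF u] CO differentiable_imp_continuous_within by blast
    then have "(\<lambda>n. V (X (k n) u, \<gamma>)) \<longlonglongrightarrow> V (y u, \<gamma>)"
      by (rule isCont_tendsto_compose[OF _ lim[OF u]])
    ultimately show ?thesis by (rule LIMSEQ_unique[symmetric])
  qed
  \<comment> \<open>\<open>W\<close> is not passed to the limit but squeezed on the limit curve. The
    endpoints are left out because the chain rule uses the two-sided derivative.\<close>
  have W0: "W (y u, \<gamma>) = 0" if u: "u \<in> {0<..<L}" for u
  proof -
    have yu: "y u \<in> O_at domf domV \<gamma>" using yC[of u] CO u by auto
    have "(y has_vector_derivative g (y u)) (at u)"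
      using deriv[of u] u by (simp add: at_within_Icc_at)
    then have "inner (gradient (\<lambda>\<zeta>. V (\<zeta>, \<gamma>)) (y u)) (g (y u)) = 0"
      using level by (intro gradient_orthogonal_to_level_curve[of _ _ _ _ "{0<..<L}" c]
          V_differentiable[OF \<gamma> yu] u) auto
    then show ?thesis using W_nonneg[OF \<gamma> yu] W_le[OF \<gamma> yu] by (simp add: g_def)
  qed
  have "g (y u) = 0" if "u \<in> {0<..<L}" for u
    unfolding g_def
    by (rule equilibrium_of_unobservable_curve[OF obs _ deriv[unfolded g_def] lipy M(1) W0 that])
      (use yC CO in blast)
  \<comment> \<open>Continuity carries the vanishing of the field to the endpoints of the
    window.\<close>
  moreover have "continuous_on (closure {0<..<L}) (\<lambda>u. g (y u))"
    using L yC by (auto intro!: continuous_on_compose2[OF cont_g y])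
  ultimately have gy: "g (y u) = 0" if "u \<in> {0..L}" for u
    using continuous_constant_on_closure[of "{0<..<L}" "\<lambda>u. g (y u)" 0 u] that L by simp
  obtain y0 where y0: "\<And>u. u \<in> {0..L} \<Longrightarrow> y u = y0"
    using has_vector_derivative_zero_constant[of "{0..L}" y] deriv gy by auto
  have "(\<lambda>n. x (t (k n))) \<longlonglongrightarrow> y0"
    unfolding lim_sequentially
  proof (intro allI impI)
    fix e :: real assume "0 < e"
    then obtain N where N: "\<And>n u. n \<ge> N \<Longrightarrow> u \<in> {0..L} \<Longrightarrow> norm (X (k n) u - y u) < e"
      using unif by blast
    have "dist (x (t (k n))) y0 < e" if "n \<ge> N" for n
    proof -
      have u: "t (k n) - a (k n) \<in> {0..L}" using t[of "k n"] by auto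
      show ?thesis using N[OF that u] y0[OF u] by (simp add: X_def dist_norm)
    qed
    then show "\<exists>N. \<forall>n\<ge>N. dist (x (t (k n))) y0 < e" by blast
  qed
  moreover have "y0 \<in> C" using yC[of 0] y0[of 0] L by simp
  moreover have "x (t n) \<in> C" for n
    using XC[of "t n - a n" n] t[of n] by (simp add: X_def)
  ultimately have "(\<lambda>n. g (x (t (k n)))) \<longlonglongrightarrow> g y0"
    by (intro continuous_on_tendsto_compose[OF cont_g]) auto
  moreover have "g y0 = 0" using gy[of 0] y0[of 0] L by simp
  ultimately show thesis using that[OF k] by (simp add: g_def)
qed

end

end

section \<open>Ergodic switching and convergence to the origin\<close>

locale observable_lyapunov_family = weak_lyapunov_family \<Gamma> domf f \<T> domV V W
  for \<Gamma> :: "'g::metric_space set"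
    and domf :: "('a::euclidean_space \<times> 'g) set"
    and f :: "'a \<times> 'g \<Rightarrow> 'a"
    and \<T> :: "('a, 'g) traj set"
    and domV :: "('a \<times> 'g) set"
    and V W :: "'a \<times> 'g \<Rightarrow> real" +
  assumes ergodic_dwell: "\<And>I x \<sigma>. (I, x, \<sigma>) \<in> \<T> \<Longrightarrow> \<sigma> \<in> S_erg \<Gamma> \<inter> S_dwell \<Gamma>"
    and observability: "\<And>\<gamma>. \<gamma> \<in> \<Gamma> \<Longrightarrow>
      obs_bwd (O_at domf domV \<gamma>) (\<lambda>\<xi>. f (\<xi>, \<gamma>)) (\<lambda>\<xi>. W (\<xi>, \<gamma>))
        = equilibria domf f \<gamma> \<inter> O_at domf domV \<gamma> \<or>
      obs_fwd (O_at domf domV \<gamma>) (\<lambda>\<xi>. f (\<xi>, \<gamma>)) (\<lambda>\<xi>. W (\<xi>, \<gamma>))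
        = equilibria domf f \<gamma> \<inter> O_at domf domV \<gamma>"
    and common_equilibrium: "(\<Inter>\<gamma>\<in>\<Gamma>. equilibria domf f \<gamma> \<inter> O_at domf domV \<gamma>) = {0}"
begin

context
  fixes I x \<sigma> K
  assumes traj: "(I, x, \<sigma>) \<in> \<T>"
    and K: "compact K" "K \<subseteq> \<O>" and in_K: "\<And>t. 0 \<le> t \<Longrightarrow> x t \<in> K"
begin

text \<open>The window argument treats one mode at a time, so the limit is proved for the times of
  each mode separately; finiteness of \<open>\<Gamma>\<close> merges the finitely many
  thresholds.\<close>

lemma speed_tendsto_zero: "((\<lambda>t. f (x t, \<sigma> t)) \<longlongrightarrow> 0) at_top"
proof (rule tendstoI)
  fix e :: real assume e: "0 < e"
  obtain \<tau> where \<tau>: "0 < \<tau>" "\<forall>t\<in>jumps \<sigma>. \<forall>t'\<in>jumps \<sigma>. t \<noteq> t' \<longrightarrow> \<tau> \<le> \<bar>t - t'\<bar>"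
    using ergodic_dwell[OF traj] unfolding S_dwell_def S_dwell_on_def by auto
  have "eventually (\<lambda>t. \<sigma> t = \<gamma> \<longrightarrow> dist (f (x t, \<sigma> t)) 0 < e) at_top" if \<gamma>: "\<gamma> \<in> \<Gamma>" for \<gamma>
  proof (rule ccontr)
    assume "\<not> ?thesis"
    then have "\<exists>t\<ge>b. \<sigma> t = \<gamma> \<and> e \<le> norm (f (x t, \<gamma>))" for b
      unfolding eventually_at_top_linorder by (auto simp: not_less)
    \<comment> \<open>The window around \<open>t n\<close> may start up to \<open>\<tau> / 4\<close>
      earlier; the margin makes it start no sooner than \<open>n\<close>.\<close>
    then have "\<forall>n::nat. \<exists>t\<ge>real n + \<tau> / 4. \<sigma> t = \<gamma> \<and> e \<le> norm (f (x t, \<gamma>))" by blast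
    from choice[OF this] obtain t where
      "\<forall>n::nat. real n + \<tau> / 4 \<le> t n \<and> \<sigma> (t n) = \<gamma> \<and> e \<le> norm (f (x (t n), \<gamma>))" ..
    then have t: "\<And>n::nat. real n + \<tau> / 4 \<le> t n" "\<And>n. \<sigma> (t n) = \<gamma>"
      "\<And>n. e \<le> norm (f (x (t n), \<gamma>))"
      by blast+
    have "\<forall>n. \<exists>a. a \<le> t n \<and> t n \<le> a + \<tau> / 4 \<and> (\<forall>u\<in>{a..a + \<tau> / 4}. \<sigma> u = \<sigma> (t n))"
    proof
      fix n
      show "\<exists>a. a \<le> t n \<and> t n \<le> a + \<tau> / 4 \<and> (\<forall>u\<in>{a..a + \<tau> / 4}. \<sigma> u = \<sigma> (t n))"
        by (rule dwell_window[OF signal[OF traj] \<tau>, of "t n"]) (intro exI conjI ballI)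
    qed
    from choice[OF this] obtain a
      where "\<forall>n. a n \<le> t n \<and> t n \<le> a n + \<tau> / 4 \<and> (\<forall>u\<in>{a n..a n + \<tau> / 4}. \<sigma> u = \<sigma> (t n))" ..
    then have a: "\<And>n. a n \<le> t n" "\<And>n. t n \<le> a n + \<tau> / 4"
      "\<And>n u. u \<in> {a n..a n + \<tau> / 4} \<Longrightarrow> \<sigma> u = \<sigma> (t n)"
      by blast+
    have an: "real n \<le> a n" for n using t(1)[of n] a(2)[of n] by linarith
    have "filterlim a at_top sequentially"
      by (rule filterlim_at_top_mono[OF filterlim_real_sequentially]) (simp add: an)
    moreover have "0 \<le> a n" for n using an[of n] by linarith
    moreover have "\<sigma> u = \<gamma>" if "u \<in> {a n..a n + \<tau> / 4}" for n u using a(3)[OF that] t(2) by simp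
    moreover have "t n \<in> {a n..a n + \<tau> / 4}" for n using a(1,2)[of n] by simp
    moreover have "0 < \<tau> / 4" using \<tau>(1) by simp
    ultimately obtain k where "(\<lambda>n. f (x (t (k n)), \<gamma>)) \<longlonglongrightarrow> 0"
      using speed_tendsto_along_mode[OF traj K in_K \<gamma> observability[OF \<gamma>], of "\<tau> / 4" a t] by metis
    then have "eventually (\<lambda>n. norm (f (x (t (k n)), \<gamma>)) < e) sequentially"
      using tendstoD[OF _ e] by fastforce
    then show False using t(3) eventually_happens by (fastforce simp: not_less[symmetric])
  qed
  then have "eventually (\<lambda>t. \<forall>\<gamma>\<in>\<Gamma>. \<sigma> t = \<gamma> \<longrightarrow> dist (f (x t, \<sigma> t)) 0 < e) at_top"
    by (intro eventually_ball_finite finite_modes ballI)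
  then show "eventually (\<lambda>t. dist (f (x t, \<sigma> t)) 0 < e) at_top"
    by eventually_elim (use mode_in[OF traj] in blast)
qed

text \<open>As the speed tends to zero, a cluster point of \<open>x\<close> is also approached at the nearby times at which
  any prescribed mode is active, and is therefore an equilibrium of every mode.\<close>

lemma cluster_point_zero:
  assumes s: "filterlim s at_top sequentially" "\<And>n::nat. 0 \<le> s n" and lim: "(\<lambda>n. x (s n)) \<longlonglongrightarrow> \<xi>"
  shows "\<xi> = 0"
proof -
  obtain T where T: "0 < T" "\<And>t \<gamma>. 0 \<le> t \<Longrightarrow> \<gamma> \<in> \<Gamma> \<Longrightarrow> \<sigma> -` {\<gamma>} \<inter> {t..t + T} \<noteq> {}"
    using ergodic_dwell[OF traj] unfolding S_erg_def S_erg_on_def by auto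
  have "\<xi> \<in> equilibria domf f \<gamma> \<inter> O_at domf domV \<gamma>" if \<gamma>: "\<gamma> \<in> \<Gamma>" for \<gamma>
  proof -
    have "\<exists>u. \<sigma> u = \<gamma> \<and> u \<in> {s n..s n + T}" for n
      using T(2)[OF s(2)[of n] \<gamma>] by auto
    then obtain u where u: "\<And>n. \<sigma> (u n) = \<gamma>" "\<And>n. u n \<in> {s n..s n + T}" by metis
    have u_top: "filterlim u at_top sequentially"
      by (rule filterlim_at_top_mono[OF s(1)]) (use u(2) in auto)
    have u0: "0 \<le> u n" for n using u(2)[of n] s(2)[of n] by auto
    have "(\<lambda>n. x (u n) - x (s n)) \<longlonglongrightarrow> 0"
    proof (rule tendstoI)
      fix e :: real assume e: "0 < e"
      \<comment> \<open>Mode \<open>\<gamma>\<close> is met within time \<open>T\<close>, so at this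
        speed the displacement is at most \<open>e / 2\<close>.\<close>
      have "eventually (\<lambda>t. dist (f (x t, \<sigma> t)) 0 < e / (2 * T)) at_top"
        using speed_tendsto_zero e T(1) by (intro tendstoD) auto
      then obtain b where b: "\<And>t. b \<le> t \<Longrightarrow> norm (f (x t, \<sigma> t)) < e / (2 * T)"
        by (auto simp: eventually_at_top_linorder)
      have "eventually (\<lambda>n. b \<le> s n) sequentially" using s(1) by (simp add: filterlim_at_top)
      then show "eventually (\<lambda>n. dist (x (u n) - x (s n)) 0 < e) sequentially"
      proof eventually_elim
        case (elim n)
        have "norm (x (u n) - x (s n) - (u n - s n) *\<^sub>R 0) \<le> e / (2 * T) * (u n - s n)"
        proof (rule traj_mean_value[OF traj])
          show "norm (f (x w, \<sigma> w) - 0) \<le> e / (2 * T)" if "w \<in> {s n..u n}" for w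
            using b[of w] that elim by simp
        qed (use s(2) u(2)[of n] e T(1) in auto)
        also have "\<dots> \<le> e / (2 * T) * T"
          using u(2)[of n] e T(1) by (intro mult_left_mono) auto
        also have "\<dots> < e" using e T(1) by simp
        finally show ?case by simp
      qed
    qed
    from tendsto_add[OF this lim] have xu: "(\<lambda>n. x (u n)) \<longlonglongrightarrow> \<xi>" by simp
    have sec: "x (u n) \<in> section_at domf \<gamma>" for n
      using in_domf[OF traj, of "u n"] half_line[OF traj] u0[of n] u(1)[of n]
      by (auto simp: section_at_def)
    have \<xi>: "\<xi> \<in> section_at domf \<gamma>"
      using closed_sequentially[OF closed_section sec xu] .
    have "(\<lambda>n. f (x (u n), \<gamma>)) \<longlonglongrightarrow> f (\<xi>, \<gamma>)"
      using continuous_on_tendsto_compose[OF continuous_on_section xu \<xi>] sec by simp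
    moreover have "(\<lambda>n. f (x (u n), \<gamma>)) \<longlonglongrightarrow> 0"
      using filterlim_compose[OF speed_tendsto_zero u_top] u(1) by simp
    ultimately have "f (\<xi>, \<gamma>) = 0" by (rule LIMSEQ_unique)
    moreover have "\<xi> \<in> K"
      using closed_sequentially[OF compact_imp_closed[OF K(1)] _ lim] in_K[OF s(2)] by simp
    ultimately show ?thesis
      using \<xi> K(2) by (auto simp: equilibria_def O_at_def)
  qed
  then show ?thesis using common_equilibrium by blast
qed

text \<open>By compactness of \<open>K\<close>, times at which \<open>x\<close> stays away from 0
  would produce a nonzero cluster point.\<close>

lemma tendsto_zero: "(x \<longlongrightarrow> 0) at_top"
proof (rule tendstoI, rule ccontr)
  fix e :: real assume e: "0 < e" and "\<not> eventually (\<lambda>t. dist (x t) 0 < e) at_top"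
  then have "\<exists>t\<ge>b. e \<le> norm (x t)" for b
    unfolding eventually_at_top_linorder by (auto simp: not_less)
  then have "\<forall>n::nat. \<exists>t\<ge>real n. e \<le> norm (x t)" by blast
  then obtain s where s: "\<And>n::nat. real n \<le> s n" "\<And>n. e \<le> norm (x (s n))" by metis
  have s0: "0 \<le> s n" for n using s(1)[of n] by linarith
  obtain \<xi> k where k: "strict_mono k" and lim: "((\<lambda>n. x (s n)) \<circ> k) \<longlonglongrightarrow> \<xi>"
    using K(1) in_K[OF s0] unfolding compact_def by metis
  have "filterlim s at_top sequentially"
    by (rule filterlim_at_top_mono[OF filterlim_real_sequentially]) (simp add: s(1))
  then have "filterlim (\<lambda>n. s (k n)) at_top sequentially"
    using filterlim_compose[OF _ filterlim_subseq[OF k]] by blast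
  then have "\<xi> = 0"
    using lim s0 by (intro cluster_point_zero[of "\<lambda>n. s (k n)"]) (auto simp: o_def)
  moreover have "e \<le> norm \<xi>"
    by (rule tendsto_lowerbound[OF tendsto_norm[OF lim]]) (use s(2) in auto)
  ultimately show False using e by simp
qed

end

lemma LAS: "LAS \<T>"
proof -
  obtain r \<rho> \<alpha> where r: "0 < r" and \<alpha>: "class_K_inf \<alpha>" and \<rho>: "cball 0 \<rho> \<subseteq> \<O>" "\<alpha> r < \<rho>"
    and bound: "\<And>I x \<sigma> t\<^sub>0 t. (I, x, \<sigma>) \<in> \<T> \<Longrightarrow> 0 \<le> t\<^sub>0 \<Longrightarrow> norm (x t\<^sub>0) \<le> r \<Longrightarrow> t\<^sub>0 \<le> t \<Longrightarrow>
      norm (x t) \<le> \<alpha> (norm (x t\<^sub>0))"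
    by (rule local_bound) (rule that)
  have "class_K (ereal r) \<alpha>" using class_K_inf_imp_class_K[OF \<alpha>] r by simp
  then have "LUS \<T>" unfolding LUS_def using r bound by blast
  \<comment> \<open>The stability radius \<open>r\<close> also serves as attraction radius, since
    \<open>\<alpha> r < \<rho>\<close> confines the trajectory to
    \<open>cball 0 \<rho>\<close>.\<close>
  moreover have "(x \<longlongrightarrow> 0) at_top" if tr: "(I, x, \<sigma>) \<in> \<T>" and x0: "norm (x 0) < r" for I x \<sigma>
  proof (rule tendsto_zero[OF tr compact_cball \<rho>(1)])
    fix t :: real assume "0 \<le> t"
    then have "norm (x t) \<le> \<alpha> (norm (x 0))" using bound[OF tr, of 0 t] x0 by simp
    also have "\<dots> \<le> \<alpha> r" using class_K_inf_le_iff[OF \<alpha>, of "norm (x 0)" r] x0 r by simp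
    finally show "x t \<in> cball 0 \<rho>" using \<rho>(2) by simp
  qed
  ultimately show ?thesis unfolding LAS_def using r by blast
qed

lemma GAS:
  assumes O: "\<O> = UNIV" and "radially_unbounded \<Gamma> domf domV V"
  shows "GAS \<T>"
proof -
  obtain \<alpha> where \<alpha>: "class_K_inf \<alpha>"
    and bound: "\<And>I x \<sigma> t\<^sub>0 t. (I, x, \<sigma>) \<in> \<T> \<Longrightarrow> 0 \<le> t\<^sub>0 \<Longrightarrow> t\<^sub>0 \<le> t \<Longrightarrow> norm (x t) \<le> \<alpha> (norm (x t\<^sub>0))"
    by (rule global_bound[OF assms]) (rule that)
  have "GUS \<T>" unfolding GUS_def using \<alpha> bound by blast
  \<comment> \<open>Attractivity is not claimed to be uniform, so the compact ball may depend on the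
    trajectory.\<close>
  moreover have "(x \<longlongrightarrow> 0) at_top" if tr: "(I, x, \<sigma>) \<in> \<T>" for I x \<sigma>
    by (rule tendsto_zero[OF tr compact_cball[of 0 "\<alpha> (norm (x 0))"]]) (use O bound[OF tr, of 0] in auto)
  ultimately show ?thesis unfolding GAS_def by blast
qed

end

theorem theorem4p7:
  fixes \<Gamma> :: "'g::metric_space set"
    and domf :: "((real ^ 'n) \<times> 'g) set"
    and f :: "(real ^ 'n) \<times> 'g \<Rightarrow> real ^ 'n"
    and \<T> :: "(real ^ 'n, 'g) traj set"
    and domV :: "((real ^ 'n) \<times> 'g) set"
    and V W :: "(real ^ 'n) \<times> 'g \<Rightarrow> real"
  assumes "finite \<Gamma>"
    and "domf \<subseteq> UNIV \<times> \<Gamma>" and "closed domf" and "continuous_on domf f"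
    and "\<forall>\<theta>\<in>\<T>. trajectory \<Gamma> domf f \<theta> \<and> forward_complete \<theta>"
    and "\<forall>(I, x, \<sigma>)\<in>\<T>. \<sigma> \<in> S_erg \<Gamma> \<inter> S_dwell \<Gamma>"
    and "F_weak_Lyapunov_pair \<Gamma> domf f \<T> domV V W"
    and "\<forall>\<gamma>\<in>\<Gamma>.
      obs_bwd (O_at domf domV \<gamma>) (\<lambda>\<xi>. f (\<xi>, \<gamma>)) (\<lambda>\<xi>. W (\<xi>, \<gamma>))
        = equilibria domf f \<gamma> \<inter> O_at domf domV \<gamma> \<or>
      obs_fwd (O_at domf domV \<gamma>) (\<lambda>\<xi>. f (\<xi>, \<gamma>)) (\<lambda>\<xi>. W (\<xi>, \<gamma>))
        = equilibria domf f \<gamma> \<inter> O_at domf domV \<gamma>"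
    and "(\<Inter>\<gamma>\<in>\<Gamma>. equilibria domf f \<gamma> \<inter> O_at domf domV \<gamma>) = {0}"
  shows "LAS \<T> \<and>
    (fst ` domV = UNIV \<and> radially_unbounded \<Gamma> domf domV V \<longrightarrow> GAS \<T>)"
proof -
  interpret observable_lyapunov_family \<Gamma> domf f \<T> domV V W
  proof
    show "trajectory \<Gamma> domf f \<theta> \<and> forward_complete \<theta>" if "\<theta> \<in> \<T>" for \<theta>
      using assms(5) that by blast
    show "\<sigma> \<in> S_erg \<Gamma> \<inter> S_dwell \<Gamma>" if "(I, x, \<sigma>) \<in> \<T>" for I x \<sigma>
      using bspec[OF assms(6) that] by simp
  qed (fact assms | rule bspec[OF assms(8)], assumption)+
  show ?thesis using LAS GAS by blast
qed

end
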